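(* In the theory $\mathsf{ZF}$ (Zermelo–Fraenkel set theory without the Axiom of Choice), the following four statements are equivalent: (1) every countable family of nonempty finite sets has a choice function; (2) König's Lemma; (3) every countable union of finite sets is countable; (4) for every nonempty partial order $\mathbb P$ whose underlying set is a countable union of finite sets, and every countable (i.e. $|\mathcal D|\leq\omega$) family $\mathcal D$ of dense subsets of $\mathbb P$, there exists a $\mathcal D$-generic filter $G\subseteq\mathbb P$.
   Context: "Countable" means of cardinality at most $\omega$. König's Lemma is the statement that every infinite, finitely branching tree (of height $\omega$, with a root) has an infinite branch. Let $\mathbb P$ be a partially ordered set with order $\leq$. A subset $D\subseteq\mathbb P$ is dense if for every $p\in\mathbb P$ there is $q\in D$ with $q\leq p$. A subset $G\subseteq\mathbb P$ is a filter if it is closed upwards ($p\in G$ and $p\leq q$ imply $q\in G$) and for all $p,q\in G$ there exists $r\in G$ with $r\leq p$ and $r\leq q$. A filter $G$ is $\mathcal D$-generic if $G\cap D\neq\varnothing$ for every $D\in\mathcal D$. *)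

theory Defs
  imports Main
begin

text \<open>
  HOL itself proves the axiom of choice, so equivalences over \<open>ZF\<close> cannot be stated about HOL sets.
  They are stated about an arbitrary first-order structure \<open>('a, E)\<close> for the language of set theory
  that satisfies the axioms of \<open>ZF\<close>: truth in all such structures is the (semantic) meaning of
  ``in the theory \<open>ZF\<close>''.  The two axiom schemes range over first-order formulas only. If they
  ranged over all HOL predicates, every model would inherit the choice principles of HOL.
\<close>

datatype fm = Mem nat nat | Eq nat nat | Neg fm | Conj fm fm | All nat fm

primrec sat :: "('a \<Rightarrow> 'a \<Rightarrow> bool) \<Rightarrow> (nat \<Rightarrow> 'a) \<Rightarrow> fm \<Rightarrow> bool" where
  "sat E v (Mem i j) \<longleftrightarrow> E (v i) (v j)"
| "sat E v (Eq i j) \<longleftrightarrow> v i = v j"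
| "sat E v (Neg \<phi>) \<longleftrightarrow> \<not> sat E v \<phi>"
| "sat E v (Conj \<phi> \<psi>) \<longleftrightarrow> sat E v \<phi> \<and> sat E v \<psi>"
| "sat E v (All i \<phi>) \<longleftrightarrow> (\<forall>a. sat E (v(i := a)) \<phi>)"

text \<open>
  Every definition in the following locale is the satisfaction clause of a first-order formula:
  it uses only membership, equality, connectives, and quantifiers over the universe \<open>'a\<close>.
\<close>

locale set_structure =
  fixes E :: "'a \<Rightarrow> 'a \<Rightarrow> bool"  (infix "\<in>\<^sub>M" 50)
begin

definition nonempty :: "'a \<Rightarrow> bool" where
  "nonempty x \<longleftrightarrow> (\<exists>z. z \<in>\<^sub>M x)"

definition subset :: "'a \<Rightarrow> 'a \<Rightarrow> bool" where
  "subset x y \<longleftrightarrow> (\<forall>z. z \<in>\<^sub>M x \<longrightarrow> z \<in>\<^sub>M y)"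

definition is_upair :: "'a \<Rightarrow> 'a \<Rightarrow> 'a \<Rightarrow> bool" where
  "is_upair z x y \<longleftrightarrow> (\<forall>w. w \<in>\<^sub>M z \<longleftrightarrow> w = x \<or> w = y)"

text \<open>Kuratowski pairs: \<open>p = {{x}, {x, y}}\<close>.\<close>

definition is_opair :: "'a \<Rightarrow> 'a \<Rightarrow> 'a \<Rightarrow> bool" where
  "is_opair p x y \<longleftrightarrow> (\<forall>z. z \<in>\<^sub>M p \<longleftrightarrow> is_upair z x x \<or> is_upair z x y)"

definition is_union :: "'a \<Rightarrow> 'a \<Rightarrow> bool" where
  "is_union u F \<longleftrightarrow> (\<forall>z. z \<in>\<^sub>M u \<longleftrightarrow> (\<exists>x. x \<in>\<^sub>M F \<and> z \<in>\<^sub>M x))"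

definition is_succ :: "'a \<Rightarrow> 'a \<Rightarrow> bool" where
  "is_succ y x \<longleftrightarrow> (\<forall>z. z \<in>\<^sub>M y \<longleftrightarrow> z \<in>\<^sub>M x \<or> z = x)"

definition is_inductive :: "'a \<Rightarrow> bool" where
  "is_inductive x \<longleftrightarrow>
     (\<exists>e. e \<in>\<^sub>M x \<and> \<not> nonempty e) \<and>
     (\<forall>y. y \<in>\<^sub>M x \<longrightarrow> (\<exists>s. s \<in>\<^sub>M x \<and> is_succ s y))"

definition is_omega :: "'a \<Rightarrow> bool" where
  "is_omega w \<longleftrightarrow> is_inductive w \<and> (\<forall>x. is_inductive x \<longrightarrow> subset w x)"

definition rel :: "'a \<Rightarrow> 'a \<Rightarrow> 'a \<Rightarrow> bool" where
  "rel r x y \<longleftrightarrow> (\<exists>p. p \<in>\<^sub>M r \<and> is_opair p x y)"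

definition function_on :: "'a \<Rightarrow> 'a \<Rightarrow> bool" where
  "function_on f a \<longleftrightarrow>
     (\<forall>p. p \<in>\<^sub>M f \<longrightarrow> (\<exists>x y. is_opair p x y \<and> x \<in>\<^sub>M a)) \<and>
     (\<forall>x. x \<in>\<^sub>M a \<longrightarrow> (\<exists>!y. rel f x y))"

definition injection :: "'a \<Rightarrow> 'a \<Rightarrow> 'a \<Rightarrow> bool" where
  "injection f a b \<longleftrightarrow>
     function_on f a \<and>
     (\<forall>x y. rel f x y \<longrightarrow> y \<in>\<^sub>M b) \<and>
     (\<forall>x x' y. rel f x y \<and> rel f x' y \<longrightarrow> x = x')"

definition bijection :: "'a \<Rightarrow> 'a \<Rightarrow> 'a \<Rightarrow> bool" where
  "bijection f a b \<longleftrightarrow> injection f a b \<and> (\<forall>y. y \<in>\<^sub>M b \<longrightarrow> (\<exists>x. rel f x y))"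

definition finite_set :: "'a \<Rightarrow> bool" where
  "finite_set x \<longleftrightarrow> (\<exists>w n f. is_omega w \<and> n \<in>\<^sub>M w \<and> bijection f x n)"

definition countable_set :: "'a \<Rightarrow> bool" where
  "countable_set x \<longleftrightarrow> (\<exists>w f. is_omega w \<and> injection f x w)"

definition choice_function :: "'a \<Rightarrow> 'a \<Rightarrow> bool" where
  "choice_function c F \<longleftrightarrow>
     function_on c F \<and> (\<forall>x y. rel c x y \<longrightarrow> y \<in>\<^sub>M x)"

definition partial_order :: "'a \<Rightarrow> 'a \<Rightarrow> bool" where
  "partial_order P r \<longleftrightarrow>
     (\<forall>p. p \<in>\<^sub>M r \<longrightarrow> (\<exists>x y. is_opair p x y \<and> x \<in>\<^sub>M P \<and> y \<in>\<^sub>M P)) \<and>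
     (\<forall>x. x \<in>\<^sub>M P \<longrightarrow> rel r x x) \<and>
     (\<forall>x y. rel r x y \<and> rel r y x \<longrightarrow> x = y) \<and>
     (\<forall>x y z. rel r x y \<and> rel r y z \<longrightarrow> rel r x z)"

definition strict :: "'a \<Rightarrow> 'a \<Rightarrow> 'a \<Rightarrow> bool" where
  "strict r x y \<longleftrightarrow> rel r x y \<and> x \<noteq> y"

text \<open>
  A tree is a partial order in which the set of strict predecessors of each node is well-ordered
  (linearity follows from the existence of least elements of two-element subsets).
\<close>

definition tree :: "'a \<Rightarrow> 'a \<Rightarrow> bool" where
  "tree T r \<longleftrightarrow>
     partial_order T r \<and>
     (\<forall>t A. t \<in>\<^sub>M T \<and> nonempty A \<and> (\<forall>s. s \<in>\<^sub>M A \<longrightarrow> strict r s t) \<longrightarrow>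
        (\<exists>m. m \<in>\<^sub>M A \<and> (\<forall>s. s \<in>\<^sub>M A \<longrightarrow> rel r m s)))"

definition rooted :: "'a \<Rightarrow> 'a \<Rightarrow> bool" where
  "rooted T r \<longleftrightarrow> (\<exists>t0. t0 \<in>\<^sub>M T \<and> (\<forall>t. t \<in>\<^sub>M T \<longrightarrow> rel r t0 t))"

text \<open>The ordinal \<open>n\<close> is the order type of the strict predecessors of \<open>t\<close>.\<close>

definition node_height :: "'a \<Rightarrow> 'a \<Rightarrow> 'a \<Rightarrow> bool" where
  "node_height r t n \<longleftrightarrow>
     (\<exists>p f. (\<forall>s. s \<in>\<^sub>M p \<longleftrightarrow> strict r s t) \<and> bijection f p n \<and>
        (\<forall>s s' m m'. rel f s m \<and> rel f s' m' \<longrightarrow> (strict r s s' \<longleftrightarrow> m \<in>\<^sub>M m')))"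

text \<open>The heights of nodes are exactly the elements of \<open>\<omega>\<close>.\<close>

definition height_omega :: "'a \<Rightarrow> 'a \<Rightarrow> bool" where
  "height_omega T r \<longleftrightarrow>
     (\<exists>w. is_omega w \<and>
        (\<forall>t. t \<in>\<^sub>M T \<longrightarrow> (\<exists>n. n \<in>\<^sub>M w \<and> node_height r t n)) \<and>
        (\<forall>n. n \<in>\<^sub>M w \<longrightarrow> (\<exists>t. t \<in>\<^sub>M T \<and> node_height r t n)))"

definition immediate_succ :: "'a \<Rightarrow> 'a \<Rightarrow> 'a \<Rightarrow> bool" where
  "immediate_succ r t s \<longleftrightarrow> strict r t s \<and> \<not> (\<exists>u. strict r t u \<and> strict r u s)"

definition finitely_branching :: "'a \<Rightarrow> 'a \<Rightarrow> bool" where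
  "finitely_branching T r \<longleftrightarrow>
     (\<forall>t. t \<in>\<^sub>M T \<longrightarrow>
        (\<exists>S. (\<forall>s. s \<in>\<^sub>M S \<longleftrightarrow> immediate_succ r t s) \<and> finite_set S))"

text \<open>A branch is a maximal chain.\<close>

definition chain :: "'a \<Rightarrow> 'a \<Rightarrow> 'a \<Rightarrow> bool" where
  "chain T r b \<longleftrightarrow>
     subset b T \<and> (\<forall>s t. s \<in>\<^sub>M b \<and> t \<in>\<^sub>M b \<longrightarrow> rel r s t \<or> rel r t s)"

definition branch :: "'a \<Rightarrow> 'a \<Rightarrow> 'a \<Rightarrow> bool" where
  "branch T r b \<longleftrightarrow> chain T r b \<and> (\<forall>c. chain T r c \<and> subset b c \<longrightarrow> c = b)"

definition dense_in :: "'a \<Rightarrow> 'a \<Rightarrow> 'a \<Rightarrow> bool" where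
  "dense_in P r D \<longleftrightarrow>
     subset D P \<and> (\<forall>p. p \<in>\<^sub>M P \<longrightarrow> (\<exists>q. q \<in>\<^sub>M D \<and> rel r q p))"

definition filter_in :: "'a \<Rightarrow> 'a \<Rightarrow> 'a \<Rightarrow> bool" where
  "filter_in P r G \<longleftrightarrow>
     subset G P \<and>
     (\<forall>p q. p \<in>\<^sub>M G \<and> rel r p q \<longrightarrow> q \<in>\<^sub>M G) \<and>
     (\<forall>p q. p \<in>\<^sub>M G \<and> q \<in>\<^sub>M G \<longrightarrow> (\<exists>s. s \<in>\<^sub>M G \<and> rel r s p \<and> rel r s q))"

definition generic_filter :: "'a \<Rightarrow> 'a \<Rightarrow> 'a \<Rightarrow> 'a \<Rightarrow> bool" where
  "generic_filter P r \<D> G \<longleftrightarrow>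
     filter_in P r G \<and> (\<forall>D. D \<in>\<^sub>M \<D> \<longrightarrow> (\<exists>x. x \<in>\<^sub>M G \<and> x \<in>\<^sub>M D))"

definition countable_union_of_finite_sets :: "'a \<Rightarrow> bool" where
  "countable_union_of_finite_sets u \<longleftrightarrow>
     (\<exists>F. countable_set F \<and> (\<forall>x. x \<in>\<^sub>M F \<longrightarrow> finite_set x) \<and> is_union u F)"

definition countable_choice_for_finite_sets :: bool where
  "countable_choice_for_finite_sets \<longleftrightarrow>
     (\<forall>F. countable_set F \<and> (\<forall>x. x \<in>\<^sub>M F \<longrightarrow> nonempty x \<and> finite_set x) \<longrightarrow>
        (\<exists>c. choice_function c F))"

definition Koenigs_lemma :: bool where
  "Koenigs_lemma \<longleftrightarrow>
     (\<forall>T r. tree T r \<and> rooted T r \<and> height_omega T r \<and> finitely_branching T r \<and>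
            \<not> finite_set T \<longrightarrow>
        (\<exists>b. branch T r b \<and> \<not> finite_set b))"

definition countable_unions_of_finite_sets_countable :: bool where
  "countable_unions_of_finite_sets_countable \<longleftrightarrow>
     (\<forall>u. countable_union_of_finite_sets u \<longrightarrow> countable_set u)"

definition generic_filters_exist :: bool where
  "generic_filters_exist \<longleftrightarrow>
     (\<forall>P r \<D>. partial_order P r \<and> nonempty P \<and> countable_union_of_finite_sets P \<and>
              countable_set \<D> \<and> (\<forall>D. D \<in>\<^sub>M \<D> \<longrightarrow> dense_in P r D) \<longrightarrow>
        (\<exists>G. generic_filter P r \<D> G))"

end

text \<open>
  In the schemes, the valuation \<open>v\<close> supplies arbitrary parameters to \<open>\<phi>\<close>, whose distinguished
  variables are \<open>0\<close> (and \<open>1\<close>).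
\<close>

locale ZF_model = set_structure +
  assumes extensionality: "(\<forall>z. z \<in>\<^sub>M x \<longleftrightarrow> z \<in>\<^sub>M y) \<Longrightarrow> x = y"
    and foundation: "nonempty x \<Longrightarrow> \<exists>y. y \<in>\<^sub>M x \<and> \<not> (\<exists>z. z \<in>\<^sub>M y \<and> z \<in>\<^sub>M x)"
    and pairing: "\<exists>z. is_upair z x y"
    and union: "\<exists>u. is_union u F"
    and power_set: "\<exists>p. \<forall>z. z \<in>\<^sub>M p \<longleftrightarrow> subset z x"
    and infinity: "\<exists>x. is_inductive x"
    and separation:
      "\<exists>b. \<forall>x. x \<in>\<^sub>M b \<longleftrightarrow> x \<in>\<^sub>M a \<and> sat (\<in>\<^sub>M) (v(0 := x)) \<phi>"
    and replacement:
      "(\<forall>x y z. x \<in>\<^sub>M a \<and> sat (\<in>\<^sub>M) (v(0 := x, 1 := y)) \<phi> \<and> sat (\<in>\<^sub>M) (v(0 := x, 1 := z)) \<phi>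
          \<longrightarrow> y = z) \<Longrightarrow>
       \<exists>b. \<forall>y. y \<in>\<^sub>M b \<longleftrightarrow> (\<exists>x. x \<in>\<^sub>M a \<and> sat (\<in>\<^sub>M) (v(0 := x, 1 := y)) \<phi>)"

end

theory Submission
  imports Defs
begin

text \<open>
  The implications form a cycle: choice, countable unions, generic filters, Koenig's Lemma, choice.
  All constructions take place inside the given model, so every set and function that is formed must be
  first-order definable with parameters.
  Given choice, pick for each member \<open>x\<close> of a countable family of finite sets a bijection with its
  cardinality, and order the union first by index and then by the chosen bijection. All initial segments
  are finite, so their cardinalities inject the union into \<open>\<omega>\<close>.
  A countable partial order has generic filters by the usual recursion that takes least elements.
  Given generic filters, the nodes of a tree that have infinitely many nodes above them, ordered in reverse,
  are a countable union of finite levels. A filter that meets the nodes of height at least \<open>n\<close> for every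
  \<open>n\<close> is an infinite branch.
  Given Koenig's Lemma, an infinite branch through the tree of finite partial choice sequences
  yields a choice function.
\<close>

subsection \<open>First-order definability with parameters\<close>

text \<open>A HOL function or predicate on the model is of use only when it is definable: separation
  and replacement apply to nothing else. HOL's numbers and \<open>finite\<close> cannot stand in for
  those of the model either: \<open>om\<close> may contain nonstandard numbers, and a set that the
  model calls finite may then have infinitely many elements when seen from HOL. So induction,
  recursion, finiteness and cardinality are rebuilt inside the model for definable data, and the
  rules collected in \<open>dfn_intros\<close> settle the definability conditions. For the same
  reason selections are replaced by least elements of \<open>om\<close>. Choice for finite sets is
  strong enough for unions because the bijections of a finite set with its cardinality again form a
  nonempty finite set: a single choice orders a whole member of the family. In the step from
  Koenig's Lemma to choice, the tree must have every finite height although the family itself may be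
  finite; the family is therefore padded to a sequence of length \<omega>.\<close>

named_theorems dfn_intros

primrec ren :: "(nat \<Rightarrow> nat) \<Rightarrow> fm \<Rightarrow> fm" where
  "ren h (Mem i j) = Mem (h i) (h j)"
| "ren h (Eq i j) = Eq (h i) (h j)"
| "ren h (Neg \<phi>) = Neg (ren h \<phi>)"
| "ren h (Conj \<phi> \<psi>) = Conj (ren h \<phi>) (ren h \<psi>)"
| "ren h (All i \<phi>) = All (h i) (ren h \<phi>)"

text \<open>Injectivity of \<open>h\<close> rules out capture: the binder updates the valuation at
  \<open>h i\<close>, and seen through \<open>h\<close> this has to be an update at \<open>i\<close>
  alone.\<close>

lemma sat_ren: "inj h \<Longrightarrow> sat E v (ren h \<phi>) \<longleftrightarrow> sat E (v \<circ> h) \<phi>"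
proof (induction \<phi> arbitrary: v)
  case (All i \<phi>)
  have "(v(h i := a)) \<circ> h = (v \<circ> h)(i := a)" for a
    using All.prems by (auto simp: fun_eq_iff inj_eq)
  then show ?case by (simp only: ren.simps sat.simps All.IH[OF All.prems])
qed auto

text \<open>
  Variables split into two copies of the naturals: the \<open>vr i\<close> carry an environment, the \<open>pr i\<close> carry
  parameters. So parameters never clash with variables.
\<close>

definition vr :: "nat \<Rightarrow> nat" where "vr i = 2 * i"
definition pr :: "nat \<Rightarrow> nat" where "pr i = Suc (2 * i)"

lemma vr_pr_inject [simp]: "vr i = vr j \<longleftrightarrow> i = j" "pr i = pr j \<longleftrightarrow> i = j" "vr i \<noteq> pr j" "pr j \<noteq> vr i"
  unfolding vr_def pr_def by presburger+

lemma vr_pr_cases: obtains i where "n = vr i" | i where "n = pr i"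
  unfolding vr_def pr_def by (metis oddE Suc_eq_plus1 evenE)

text \<open>Serves two purposes: it merges parameters (first argument) and environment (second
  argument) into one valuation, and with values in \<open>nat\<close> it builds a renaming from its
  action on \<open>pr\<close> and on \<open>vr\<close>.\<close>

definition join :: "(nat \<Rightarrow> 'b) \<Rightarrow> (nat \<Rightarrow> 'b) \<Rightarrow> nat \<Rightarrow> 'b" where
  "join s e n = (if even n then e (n div 2) else s (n div 2))"

lemma join_simps [simp]: "join s e (vr i) = e i" "join s e (pr i) = s i"
  by (auto simp: join_def vr_def pr_def)

lemma inj_join: "inj f \<Longrightarrow> inj g \<Longrightarrow> (\<And>i j. f i \<noteq> g j) \<Longrightarrow> inj (join f g)"
proof (rule injI)
  fix m n assume *: "inj f" "inj g" "\<And>i j. f i \<noteq> g j" "join f g m = join f g n"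
  have **: "g j \<noteq> f i" for i j using *(3)[of i j] by simp
  show "m = n"
    by (rule vr_pr_cases[of m]; rule vr_pr_cases[of n]) (use * ** in \<open>auto simp: inj_eq\<close>)
qed

text \<open>Reduces every closure proof below to bookkeeping: it is enough to say where each
  variable is sent.\<close>

lemma sat_join_ren:
  assumes "inj h" "\<And>i. join s' e' (h (vr i)) = e i" "\<And>i. join s' e' (h (pr i)) = s i"
  shows "sat E (join s' e') (ren h \<phi>) \<longleftrightarrow> sat E (join s e) \<phi>"
proof -
  have "(join s' e' \<circ> h) n = join s e n" for n
    by (rule vr_pr_cases[of n]) (use assms(2,3) in auto)
  then have "join s' e' \<circ> h = join s e" by blast
  then show ?thesis using assms(1) by (simp add: sat_ren)
qed

context set_structure
begin

text \<open>
  \<open>dfn P\<close>: the predicate \<open>P\<close> of an environment is first-order definable with parameters.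
  Environments are de Bruijn style, so that passing under a quantifier shifts the indices.
\<close>

definition dfn :: "((nat \<Rightarrow> 'a) \<Rightarrow> bool) \<Rightarrow> bool" where
  "dfn P \<longleftrightarrow> (\<exists>\<phi> s. \<forall>e. P e \<longleftrightarrow> sat (\<in>\<^sub>M) (join s e) \<phi>)"

text \<open>The language has no function symbols, so a term is handled through its graph: the value
  has index 0 and the environment of the term is shifted up by one.\<close>

definition tdf :: "((nat \<Rightarrow> 'a) \<Rightarrow> 'a) \<Rightarrow> bool" where
  "tdf t \<longleftrightarrow> dfn (\<lambda>e. e 0 = t (\<lambda>i. e (Suc i)))"

abbreviation tdf1 :: "('a \<Rightarrow> 'a) \<Rightarrow> bool" where "tdf1 f \<equiv> tdf (\<lambda>e. f (e 0))"
abbreviation dfn1 :: "('a \<Rightarrow> bool) \<Rightarrow> bool" where "dfn1 P \<equiv> dfn (\<lambda>e. P (e 0))"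
abbreviation dfn2 :: "('a \<Rightarrow> 'a \<Rightarrow> bool) \<Rightarrow> bool" where "dfn2 P \<equiv> dfn (\<lambda>e. P (e 0) (e (Suc 0)))"
abbreviation tdf2 :: "('a \<Rightarrow> 'a \<Rightarrow> 'a) \<Rightarrow> bool" where "tdf2 f \<equiv> tdf (\<lambda>e. f (e 0) (e (Suc 0)))"

section \<open>Closure properties of definability\<close>

lemma dfn_neg [dfn_intros]: "dfn P \<Longrightarrow> dfn (\<lambda>e. \<not> P e)"
  unfolding dfn_def by (metis sat.simps(3))

lemma dfn_conj [dfn_intros]:
  assumes "dfn P" "dfn Q" shows "dfn (\<lambda>e. P e \<and> Q e)"
proof -
  obtain \<phi> s where P: "\<And>e. P e \<longleftrightarrow> sat (\<in>\<^sub>M) (join s e) \<phi>" using assms(1) unfolding dfn_def by auto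
  obtain \<psi> t where Q: "\<And>e. Q e \<longleftrightarrow> sat (\<in>\<^sub>M) (join t e) \<psi>" using assms(2) unfolding dfn_def by auto
  \<comment> \<open>Both formulas bring infinitely many parameters. The parameter slots are split
    once more into two copies: those of \<open>\<phi>\<close> move to the slots \<open>vr i\<close>
    and those of \<open>\<psi>\<close> to the slots \<open>pr i\<close>.\<close>
  let ?h = "join (\<lambda>i. pr (vr i)) vr" and ?k = "join (\<lambda>i. pr (pr i)) vr"
  have inj: "inj ?h" "inj ?k" by (intro inj_join; simp add: inj_on_def)+
  have "P e \<and> Q e \<longleftrightarrow> sat (\<in>\<^sub>M) (join (join t s) e) (Conj (ren ?h \<phi>) (ren ?k \<psi>))" for e
    unfolding P Q sat.simps
    by (intro arg_cong2[where f = conj] sat_join_ren[symmetric] inj) simp_all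
  then show ?thesis unfolding dfn_def by blast
qed

lemma dfn_all [dfn_intros]:
  assumes "dfn (\<lambda>e. Q (\<lambda>i. e (Suc i)) (e 0))" shows "dfn (\<lambda>e. \<forall>a. Q e a)"
proof -
  obtain \<phi> s where Q: "\<And>e. Q (\<lambda>i. e (Suc i)) (e 0) \<longleftrightarrow> sat (\<in>\<^sub>M) (join s e) \<phi>"
    using assms unfolding dfn_def by auto
  \<comment> \<open>All \<open>vr\<close> variables are occupied by the environment, so the
    quantifier binds a parameter slot: the parameters move up by one and \<open>pr 0\<close> becomes
    free. Its initial value in \<open>?s\<close> is overwritten by the quantifier.\<close>
  let ?h = "join (\<lambda>i. pr (Suc i)) (case_nat (pr 0) vr)"
  have inj: "inj ?h"
    by (intro inj_join) (auto simp: inj_on_def split: nat.splits)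
  let ?s = "case_nat undefined s"
  have "Q e a \<longleftrightarrow> sat (\<in>\<^sub>M) ((join ?s e)(pr 0 := a)) (ren ?h \<phi>)" for e a
  proof -
    have "((join ?s e)(pr 0 := a)) n = join (case_nat a s) e n" for n
      by (rule vr_pr_cases[of n]) (auto split: nat.splits)
    then have eq: "(join ?s e)(pr 0 := a) = join (case_nat a s) e" by blast
    have "sat (\<in>\<^sub>M) (join (case_nat a s) e) (ren ?h \<phi>) \<longleftrightarrow> sat (\<in>\<^sub>M) (join s (case_nat a e)) \<phi>"
      by (rule sat_join_ren[OF inj]) (auto split: nat.splits)
    also have "\<dots> \<longleftrightarrow> Q e a" using Q[of "case_nat a e"] by simp
    finally show ?thesis unfolding eq by blast
  qed
  then have "(\<forall>a. Q e a) \<longleftrightarrow> sat (\<in>\<^sub>M) (join ?s e) (All (pr 0) (ren ?h \<phi>))" for e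
    by simp
  then show ?thesis unfolding dfn_def by blast
qed

lemma dfn_reindex:
  assumes "dfn P" "inj h" shows "dfn (\<lambda>e. P (\<lambda>i. e (h i)))"
proof -
  obtain \<phi> s where P: "\<And>e. P e \<longleftrightarrow> sat (\<in>\<^sub>M) (join s e) \<phi>" using assms(1) unfolding dfn_def by auto
  let ?h = "join pr (\<lambda>i. vr (h i))"
  have inj: "inj ?h" by (intro inj_join) (auto simp: inj_on_def inj_eq[OF assms(2)])
  have "P (\<lambda>i. e (h i)) \<longleftrightarrow> sat (\<in>\<^sub>M) (join s e) (ren ?h \<phi>)" for e
    unfolding P by (intro sat_join_ren[symmetric] inj) simp_all
  then show ?thesis unfolding dfn_def by blast
qed

lemma dfn_mem_var: "dfn (\<lambda>e. e i \<in>\<^sub>M e j)"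
  unfolding dfn_def by (rule exI[of _ "Mem (vr i) (vr j)"]) simp

lemma dfn_eq_var: "dfn (\<lambda>e. e i = e j)"
  unfolding dfn_def by (rule exI[of _ "Eq (vr i) (vr j)"]) simp

lemma dfn_eq_const: "dfn (\<lambda>e. e i = c)"
  unfolding dfn_def
  by (rule exI[of _ "Eq (vr i) (pr 0)"], rule exI[of _ "\<lambda>_. c"]) simp

lemma dfn_const [dfn_intros]: "dfn (\<lambda>e. B)"
proof (cases B)
  case True
  then show ?thesis using dfn_eq_var[of 0 0] by simp
next
  case False
  then show ?thesis using dfn_neg[OF dfn_eq_var[of 0 0]] by simp
qed

lemma dfn_imp [dfn_intros]: "dfn P \<Longrightarrow> dfn Q \<Longrightarrow> dfn (\<lambda>e. P e \<longrightarrow> Q e)"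
  using dfn_neg[OF dfn_conj[OF _ dfn_neg], of P Q] by (rule back_subst[where P = dfn]) auto

lemma dfn_disj [dfn_intros]: "dfn P \<Longrightarrow> dfn Q \<Longrightarrow> dfn (\<lambda>e. P e \<or> Q e)"
  using dfn_imp[OF dfn_neg, of P Q] by (rule back_subst[where P = dfn]) auto

lemma dfn_iff [dfn_intros]: "dfn P \<Longrightarrow> dfn Q \<Longrightarrow> dfn (\<lambda>e. P e \<longleftrightarrow> Q e)"
  using dfn_conj[OF dfn_imp dfn_imp, of P Q Q P] by (rule back_subst[where P = dfn]) auto

lemma dfn_ex [dfn_intros]:
  assumes "dfn (\<lambda>e. Q (\<lambda>i. e (Suc i)) (e 0))" shows "dfn (\<lambda>e. \<exists>a. Q e a)"
  using dfn_neg[OF dfn_all[where Q = "\<lambda>e a. \<not> Q e a", OF dfn_neg[OF assms]]] by simp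

text \<open>Index 1 is skipped: the form needed when the same body stands under a second quantifier,
  as in the uniqueness half of \<open>Ex1\<close>.\<close>

lemma dfn_under: "dfn (\<lambda>e. Q (\<lambda>i. e (Suc i)) (e 0)) \<Longrightarrow> dfn (\<lambda>e. Q (\<lambda>i. e (Suc (Suc i))) (e 0))"
  using dfn_reindex[of "\<lambda>e. Q (\<lambda>i. e (Suc i)) (e 0)" "\<lambda>i. case i of 0 \<Rightarrow> 0 | Suc j \<Rightarrow> Suc (Suc j)"]
  by (auto simp: inj_on_def split: nat.splits)

lemma dfn_ex1 [dfn_intros]:
  assumes "dfn (\<lambda>e. Q (\<lambda>i. e (Suc i)) (e 0))" shows "dfn (\<lambda>e. \<exists>!a. Q e a)"
  unfolding Ex1_def by (intro dfn_intros assms dfn_under dfn_eq_var)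

lemma dfn_shift: "dfn P \<Longrightarrow> dfn (\<lambda>e. P (\<lambda>i. e (Suc i)))"
  by (rule dfn_reindex) auto

lemma tdf_shift: "tdf t \<Longrightarrow> tdf (\<lambda>e. t (\<lambda>i. e (Suc i)))"
  unfolding tdf_def by (rule dfn_under)

lemma tdf_graph: "tdf t \<Longrightarrow> dfn (\<lambda>e. e 0 = t (\<lambda>i. e (Suc i)))"
  unfolding tdf_def .

text \<open>One-point rule: \<open>Q e (t e)\<close> says that some \<open>a\<close> equal to
  \<open>t e\<close> satisfies \<open>Q e a\<close>, and this uses only the graph of
  \<open>t\<close>.\<close>

lemma dfn_subst:
  assumes "dfn (\<lambda>e. Q (\<lambda>i. e (Suc i)) (e 0))" "tdf t"
  shows "dfn (\<lambda>e. Q e (t e))"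
proof -
  have "dfn (\<lambda>e. \<exists>a. a = t e \<and> Q e a)"
    by (intro dfn_intros assms tdf_graph)
  then show ?thesis by simp
qed

lemma tdf_var [dfn_intros]: "tdf (\<lambda>e. e i)"
  unfolding tdf_def by (rule dfn_eq_var)

lemma tdf_const [dfn_intros]: "tdf (\<lambda>e. c)"
  unfolding tdf_def by (rule dfn_eq_const)

text \<open>The hypothesis asks for all pairs of indices, equal ones included, because each
  substitution shifts the variables that remain. A new notion is thus shown definable on variables
  only and then holds for arbitrary definable terms.\<close>

lemma dfn_subst2:
  assumes "\<And>i j. dfn (\<lambda>e. R (e i) (e j))" "tdf t" "tdf u"
  shows "dfn (\<lambda>e. R (t e) (u e))"
  by (rule dfn_subst[where Q = "\<lambda>e a. R a (u e)"], rule dfn_subst[where Q = "\<lambda>e a. R (e 0) a"])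
     (intro assms tdf_shift)+

lemma dfn_subst1:
  assumes "\<And>i. dfn (\<lambda>e. R (e i))" "tdf t" shows "dfn (\<lambda>e. R (t e))"
  by (rule dfn_subst[where Q = "\<lambda>e a. R a"]) (intro assms)+

lemma dfn_subst3:
  assumes "\<And>i j k. dfn (\<lambda>e. R (e i) (e j) (e k))" "tdf t" "tdf u" "tdf w"
  shows "dfn (\<lambda>e. R (t e) (u e) (w e))"
proof -
  have 1: "dfn (\<lambda>e. R (e i) (e j) (w e))" if "tdf w" for w i j
    by (rule dfn_subst[where Q = "\<lambda>e a. R (e i) (e j) a"]) (intro assms that)+
  have 2: "dfn (\<lambda>e. R (e i) (u e) (w e))" if "tdf u" "tdf w" for u w i
    by (rule dfn_subst[where Q = "\<lambda>e a. R (e i) a (w e)"]) (intro 1 that tdf_shift)+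
  show ?thesis
    by (rule dfn_subst[where Q = "\<lambda>e a. R a (u e) (w e)"]) (intro 2 assms tdf_shift)+
qed

lemma dfn_mem [dfn_intros]: "tdf t \<Longrightarrow> tdf u \<Longrightarrow> dfn (\<lambda>e. t e \<in>\<^sub>M u e)"
  by (rule dfn_subst2[where R = "(\<in>\<^sub>M)"]) (auto intro: dfn_mem_var)

lemma dfn_eq [dfn_intros]: "tdf t \<Longrightarrow> tdf u \<Longrightarrow> dfn (\<lambda>e. t e = u e)"
  by (rule dfn_subst2[where R = "(=)"]) (auto intro: dfn_eq_var)

lemma tdf_subst:
  assumes "tdf (\<lambda>e. f (\<lambda>i. e (Suc i)) (e 0))" "tdf t"
  shows "tdf (\<lambda>e. f e (t e))"
  unfolding tdf_def
proof (rule dfn_subst[where Q = "\<lambda>e a. e 0 = f (\<lambda>i. e (Suc i)) a"])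
  show "dfn (\<lambda>e. e (Suc 0) = f (\<lambda>i. e (Suc (Suc i))) (e 0))"
    using dfn_reindex[OF assms(1)[unfolded tdf_def], of "\<lambda>i. case i of 0 \<Rightarrow> 1 | Suc 0 \<Rightarrow> 0 | Suc (Suc j) \<Rightarrow> Suc (Suc j)"]
    by (auto simp: inj_on_def split: nat.splits)
qed (intro tdf_shift assms)

lemma tdf_subst1:
  assumes "\<And>i. tdf (\<lambda>e. f (e i))" "tdf t" shows "tdf (\<lambda>e. f (t e))"
  by (rule tdf_subst[where f = "\<lambda>e a. f a"]) (intro assms)+

lemma tdf_subst2:
  assumes "\<And>i j. tdf (\<lambda>e. f (e i) (e j))" "tdf t" "tdf u"
  shows "tdf (\<lambda>e. f (t e) (u e))"
  by (rule tdf_subst[where f = "\<lambda>e a. f a (u e)"], rule tdf_subst[where f = "\<lambda>e a. f (e 0) a"])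
     (intro assms tdf_shift)+

lemma tdf1_app: "tdf1 f \<Longrightarrow> tdf t \<Longrightarrow> tdf (\<lambda>e. f (t e))"
  by (rule tdf_subst[where f = "\<lambda>e a. f a"])

lemma dfn1_app: "dfn1 P \<Longrightarrow> tdf t \<Longrightarrow> dfn (\<lambda>e. P (t e))"
  by (rule dfn_subst[where Q = "\<lambda>e a. P a"])

lemma dfn2_app:
  assumes "dfn2 R" "tdf t" "tdf u" shows "dfn (\<lambda>e. R (t e) (u e))"
proof -
  \<comment> \<open>Under the two quantifiers \<open>b\<close> has index 0 and \<open>a\<close> has
    index 1, so the arguments of \<open>R\<close> have to be swapped.\<close>
  have inj: "inj (case_nat 1 (case_nat 0 (\<lambda>i. Suc (Suc i))))"
    by (auto simp: inj_on_def split: nat.splits)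
  have "dfn (\<lambda>e. \<exists>a b. a = t e \<and> b = u e \<and> R a b)"
    using dfn_reindex[OF assms(1) inj]
    by (intro dfn_intros tdf_shift[OF tdf_shift] assms) simp
  then show ?thesis by simp
qed

lemma tdf2_app:
  assumes "tdf2 f" "tdf t" "tdf u" shows "tdf (\<lambda>e. f (t e) (u e))"
proof -
  have inj: "inj (case_nat 2 (case_nat 1 (case_nat 0 (\<lambda>i. i + 3))))"
    by (auto simp: inj_on_def split: nat.splits)
  have graph: "dfn (\<lambda>e. e (Suc (Suc 0)) = f (e (Suc 0)) (e 0))"
    using dfn_reindex[OF assms(1)[unfolded tdf_def] inj] by (simp add: numeral_2_eq_2)
  have "dfn (\<lambda>e. \<exists>a b. a = t (\<lambda>i. e (Suc i)) \<and> b = u (\<lambda>i. e (Suc i)) \<and> e 0 = f a b)"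
    by (intro dfn_ex dfn_conj; (rule graph | intro dfn_intros tdf_shift[OF tdf_shift[OF tdf_shift]] assms))
  then show ?thesis unfolding tdf_def by simp
qed

lemma tdf_if [dfn_intros]:
  assumes "dfn P" "tdf t" "tdf u" shows "tdf (\<lambda>e. if P e then t e else u e)"
proof -
  have "dfn (\<lambda>e. (P (\<lambda>i. e (Suc i)) \<and> e 0 = t (\<lambda>i. e (Suc i))) \<or>
     (\<not> P (\<lambda>i. e (Suc i)) \<and> e 0 = u (\<lambda>i. e (Suc i))))"
    by (intro dfn_intros dfn_shift assms tdf_shift)
  then show ?thesis unfolding tdf_def by (rule back_subst[where P = dfn]) auto
qed

text \<open>
  Definite descriptions with a fixed default value. Unlike \<open>THE\<close>, which is underspecified for each
  bad predicate separately, they are definable.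
\<close>

definition desc :: "('a \<Rightarrow> bool) \<Rightarrow> 'a" where
  "desc Q = (if \<exists>!y. Q y then THE y. Q y else undefined)"

lemma desc_eq: "Q y \<Longrightarrow> (\<And>z. Q z \<Longrightarrow> z = y) \<Longrightarrow> desc Q = y"
  unfolding desc_def by (metis the_equality)

lemma desc_sat: "\<exists>!y. Q y \<Longrightarrow> Q (desc Q)"
  using desc_eq[of Q] by metis

lemma tdf_desc [dfn_intros]:
  assumes "dfn (\<lambda>e. Q (\<lambda>i. e (Suc i)) (e 0))" shows "tdf (\<lambda>e. desc (Q e))"
proof -
  have "dfn (\<lambda>e. if \<exists>!y. Q (\<lambda>i. e (Suc i)) y then Q (\<lambda>i. e (Suc i)) (e 0) else e 0 = undefined)"
    unfolding if_bool_eq_conj by (intro dfn_intros assms dfn_under)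
  moreover have "(if \<exists>!y. R y then R y else y = undefined) \<longleftrightarrow> y = desc R" for R y
  proof (cases "\<exists>!y. R y")
    case True
    then show ?thesis using desc_sat[OF True] by metis
  next
    case False
    then show ?thesis unfolding desc_def by (simp only: if_False)
  qed
  ultimately show ?thesis unfolding tdf_def by (simp only:)
qed

lemma tdf_reindex:
  assumes "tdf t" "inj h" shows "tdf (\<lambda>e. t (\<lambda>i. e (h i)))"
proof -
  have inj: "inj (case_nat 0 (\<lambda>i. Suc (h i)))"
    by (rule injI) (auto simp: inj_eq[OF assms(2)] split: nat.splits)
  show ?thesis using dfn_reindex[OF assms(1)[unfolded tdf_def] inj] unfolding tdf_def by simp
qed

lemma tdf_under:
  assumes "tdf (\<lambda>e. f (\<lambda>i. e (Suc i)) (e 0))"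
  shows "tdf (\<lambda>e. f (\<lambda>i. e (Suc (Suc i))) (e 0))"
proof -
  have inj: "inj (case_nat 0 (\<lambda>i. Suc (Suc i)))" by (auto simp: inj_on_def split: nat.splits)
  show ?thesis using tdf_reindex[OF assms inj] by simp
qed

section \<open>Definability of the notions of the statement\<close>

lemma dfn_nonempty [dfn_intros]: "tdf t \<Longrightarrow> dfn (\<lambda>e. nonempty (t e))"
  by (rule dfn_subst1) (unfold nonempty_def; intro dfn_intros)

lemma dfn_subset [dfn_intros]: "tdf t \<Longrightarrow> tdf u \<Longrightarrow> dfn (\<lambda>e. subset (t e) (u e))"
  by (rule dfn_subst2) (unfold subset_def; intro dfn_intros)

lemma dfn_is_upair [dfn_intros]: "tdf t \<Longrightarrow> tdf u \<Longrightarrow> tdf w \<Longrightarrow> dfn (\<lambda>e. is_upair (t e) (u e) (w e))"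
  by (rule dfn_subst3) (unfold is_upair_def; intro dfn_intros)

lemma dfn_is_opair [dfn_intros]: "tdf t \<Longrightarrow> tdf u \<Longrightarrow> tdf w \<Longrightarrow> dfn (\<lambda>e. is_opair (t e) (u e) (w e))"
  by (rule dfn_subst3) (unfold is_opair_def; intro dfn_intros)

lemma dfn_is_union [dfn_intros]: "tdf t \<Longrightarrow> tdf u \<Longrightarrow> dfn (\<lambda>e. is_union (t e) (u e))"
  by (rule dfn_subst2) (unfold is_union_def; intro dfn_intros)

lemma dfn_is_succ [dfn_intros]: "tdf t \<Longrightarrow> tdf u \<Longrightarrow> dfn (\<lambda>e. is_succ (t e) (u e))"
  by (rule dfn_subst2) (unfold is_succ_def; intro dfn_intros)

lemma dfn_is_inductive [dfn_intros]: "tdf t \<Longrightarrow> dfn (\<lambda>e. is_inductive (t e))"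
  by (rule dfn_subst1) (unfold is_inductive_def; intro dfn_intros)

lemma dfn_is_omega [dfn_intros]: "tdf t \<Longrightarrow> dfn (\<lambda>e. is_omega (t e))"
  by (rule dfn_subst1) (unfold is_omega_def; intro dfn_intros)

lemma dfn_rel [dfn_intros]: "tdf t \<Longrightarrow> tdf u \<Longrightarrow> tdf w \<Longrightarrow> dfn (\<lambda>e. rel (t e) (u e) (w e))"
  by (rule dfn_subst3) (unfold rel_def; intro dfn_intros)

lemma dfn_function_on [dfn_intros]: "tdf t \<Longrightarrow> tdf u \<Longrightarrow> dfn (\<lambda>e. function_on (t e) (u e))"
  by (rule dfn_subst2) (unfold function_on_def; intro dfn_intros)

lemma dfn_injection [dfn_intros]: "tdf t \<Longrightarrow> tdf u \<Longrightarrow> tdf w \<Longrightarrow> dfn (\<lambda>e. injection (t e) (u e) (w e))"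
  by (rule dfn_subst3) (unfold injection_def; intro dfn_intros)

lemma dfn_bijection [dfn_intros]: "tdf t \<Longrightarrow> tdf u \<Longrightarrow> tdf w \<Longrightarrow> dfn (\<lambda>e. bijection (t e) (u e) (w e))"
  by (rule dfn_subst3) (unfold bijection_def; intro dfn_intros)

lemma dfn_finite_set [dfn_intros]: "tdf t \<Longrightarrow> dfn (\<lambda>e. finite_set (t e))"
  by (rule dfn_subst1) (unfold finite_set_def; intro dfn_intros)

lemma dfn_strict [dfn_intros]: "tdf t \<Longrightarrow> tdf u \<Longrightarrow> tdf w \<Longrightarrow> dfn (\<lambda>e. strict (t e) (u e) (w e))"
  by (rule dfn_subst3) (unfold strict_def; intro dfn_intros)

lemma dfn_immediate_succ [dfn_intros]:
  "tdf t \<Longrightarrow> tdf u \<Longrightarrow> tdf w \<Longrightarrow> dfn (\<lambda>e. immediate_succ (t e) (u e) (w e))"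
  by (rule dfn_subst3) (unfold immediate_succ_def; intro dfn_intros)

section \<open>Set operations as definable terms\<close>

definition ext :: "'a \<Rightarrow> 'a set" where "ext x = {z. z \<in>\<^sub>M x}"

text \<open>No axiom is available in this locale. Through \<open>desc\<close> the operations are
  nevertheless total definable terms; that they have the intended elements is proved later, from the
  axioms.\<close>

definition emp :: 'a where "emp = desc (\<lambda>z. \<not> nonempty z)"
definition upair :: "'a \<Rightarrow> 'a \<Rightarrow> 'a" where "upair x y = desc (\<lambda>z. is_upair z x y)"
definition opair :: "'a \<Rightarrow> 'a \<Rightarrow> 'a" where "opair x y = desc (\<lambda>z. is_opair z x y)"
definition un :: "'a \<Rightarrow> 'a" where "un F = desc (\<lambda>u. is_union u F)"
definition Pw :: "'a \<Rightarrow> 'a" where "Pw x = desc (\<lambda>p. \<forall>z. z \<in>\<^sub>M p \<longleftrightarrow> subset z x)"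
definition cup :: "'a \<Rightarrow> 'a \<Rightarrow> 'a" where "cup x y = un (upair x y)"
definition ins :: "'a \<Rightarrow> 'a \<Rightarrow> 'a" where "ins a x = cup (upair a a) x"
definition om :: 'a where "om = desc is_omega"
definition app :: "'a \<Rightarrow> 'a \<Rightarrow> 'a" where "app f x = desc (\<lambda>y. rel f x y)"
definition Sep :: "'a \<Rightarrow> ('a \<Rightarrow> bool) \<Rightarrow> 'a" where
  "Sep A P = desc (\<lambda>b. \<forall>z. z \<in>\<^sub>M b \<longleftrightarrow> z \<in>\<^sub>M A \<and> P z)"
definition Repl :: "'a \<Rightarrow> ('a \<Rightarrow> 'a) \<Rightarrow> 'a" where
  "Repl A f = desc (\<lambda>b. \<forall>y. y \<in>\<^sub>M b \<longleftrightarrow> (\<exists>x. x \<in>\<^sub>M A \<and> y = f x))"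
definition prod :: "'a \<Rightarrow> 'a \<Rightarrow> 'a" where
  "prod A B = un (Repl A (\<lambda>a. Repl B (\<lambda>b. opair a b)))"
definition lam :: "'a \<Rightarrow> ('a \<Rightarrow> 'a) \<Rightarrow> 'a" where
  "lam A f = Repl A (\<lambda>x. opair x (f x))"

lemma tdf_upair [dfn_intros]: "tdf t \<Longrightarrow> tdf u \<Longrightarrow> tdf (\<lambda>e. upair (t e) (u e))"
  by (rule tdf_subst2) (unfold upair_def; intro dfn_intros)

lemma tdf_opair [dfn_intros]: "tdf t \<Longrightarrow> tdf u \<Longrightarrow> tdf (\<lambda>e. opair (t e) (u e))"
  by (rule tdf_subst2) (unfold opair_def; intro dfn_intros)

lemma tdf_un [dfn_intros]: "tdf t \<Longrightarrow> tdf (\<lambda>e. un (t e))"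
  by (rule tdf_subst1) (unfold un_def; intro dfn_intros)

lemma tdf_Pw [dfn_intros]: "tdf t \<Longrightarrow> tdf (\<lambda>e. Pw (t e))"
  by (rule tdf_subst1) (unfold Pw_def; intro dfn_intros)

lemma tdf_cup [dfn_intros]: "tdf t \<Longrightarrow> tdf u \<Longrightarrow> tdf (\<lambda>e. cup (t e) (u e))"
  by (rule tdf_subst2) (unfold cup_def; intro dfn_intros)

lemma tdf_ins [dfn_intros]: "tdf t \<Longrightarrow> tdf u \<Longrightarrow> tdf (\<lambda>e. ins (t e) (u e))"
  by (rule tdf_subst2) (unfold ins_def; intro dfn_intros)

lemma tdf_app [dfn_intros]: "tdf t \<Longrightarrow> tdf u \<Longrightarrow> tdf (\<lambda>e. app (t e) (u e))"
  by (rule tdf_subst2) (unfold app_def; intro dfn_intros)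

lemma tdf_Sep [dfn_intros]:
  "tdf A \<Longrightarrow> dfn (\<lambda>e. P (\<lambda>i. e (Suc i)) (e 0)) \<Longrightarrow> tdf (\<lambda>e. Sep (A e) (P e))"
  unfolding Sep_def
  by (intro dfn_intros tdf_shift[OF tdf_shift] dfn_under)

lemma tdf_Repl [dfn_intros]:
  "tdf A \<Longrightarrow> tdf (\<lambda>e. f (\<lambda>i. e (Suc i)) (e 0)) \<Longrightarrow> tdf (\<lambda>e. Repl (A e) (f e))"
  unfolding Repl_def
  by (intro dfn_intros tdf_shift[OF tdf_shift[OF tdf_shift]] tdf_under[of "\<lambda>e. f (\<lambda>i. e (Suc i))", OF tdf_under])

lemma tdf_prod [dfn_intros]: "tdf t \<Longrightarrow> tdf u \<Longrightarrow> tdf (\<lambda>e. prod (t e) (u e))"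
  by (rule tdf_subst2) (unfold prod_def; intro dfn_intros)

end

context ZF_model
begin

subsection \<open>Sets in a model\<close>

lemma set_ext: "(\<And>z. z \<in>\<^sub>M x \<longleftrightarrow> z \<in>\<^sub>M y) \<Longrightarrow> x = y"
  using extensionality by blast

lemma mem_ext [simp]: "z \<in> ext x \<longleftrightarrow> z \<in>\<^sub>M x" by (simp add: ext_def)

text \<open>Extensionality supplies the uniqueness that \<open>desc\<close> requires, so each
  operation needs only an existence axiom.\<close>

lemma mem_desc:
  assumes "\<exists>b. \<forall>z. z \<in>\<^sub>M b \<longleftrightarrow> P z"
  shows "z \<in>\<^sub>M desc (\<lambda>b. \<forall>z. z \<in>\<^sub>M b \<longleftrightarrow> P z) \<longleftrightarrow> P z"
proof -
  obtain b where b: "\<forall>z. z \<in>\<^sub>M b \<longleftrightarrow> P z" using assms by blast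
  have "desc (\<lambda>b. \<forall>z. z \<in>\<^sub>M b \<longleftrightarrow> P z) = b"
    by (rule desc_eq) (rule b, rule set_ext, simp add: b)
  then show ?thesis using b by simp
qed

text \<open>Translates between the two conventions for variables: the distinguished variable becomes
  number 0, and all others move up by two, clear of the numbers 0 and 1 that the schemes
  reserve.\<close>

lemma separation_dfn:
  assumes "dfn1 P" shows "\<exists>b. \<forall>x. x \<in>\<^sub>M b \<longleftrightarrow> x \<in>\<^sub>M a \<and> P x"
proof -
  obtain \<phi> s where P: "\<And>e. P (e 0) \<longleftrightarrow> sat (\<in>\<^sub>M) (join s e) \<phi>" using assms unfolding dfn_def by auto
  let ?h = "join (\<lambda>i. Suc (Suc (pr i))) (case_nat 0 (\<lambda>i. Suc (Suc (vr i))))"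
  let ?v = "\<lambda>n. case n of Suc (Suc m) \<Rightarrow> join s undefined m | _ \<Rightarrow> undefined"
  have inj: "inj ?h" by (intro inj_join) (auto simp: inj_on_def split: nat.splits)
  have "P x \<longleftrightarrow> sat (\<in>\<^sub>M) (?v(0 := x)) (ren ?h \<phi>)" for x
  proof -
    have "(?v(0 := x) \<circ> ?h) n = join s (case_nat x undefined) n" for n
      by (rule vr_pr_cases[of n]) (auto split: nat.splits)
    then have "?v(0 := x) \<circ> ?h = join s (case_nat x undefined)" by blast
    then show ?thesis using P[of "case_nat x undefined"] unfolding sat_ren[OF inj] by simp
  qed
  then show ?thesis using separation[of a ?v "ren ?h \<phi>"] by simp
qed

lemma replacement_dfn:
  assumes "tdf1 f" shows "\<exists>b. \<forall>y. y \<in>\<^sub>M b \<longleftrightarrow> (\<exists>x. x \<in>\<^sub>M a \<and> y = f x)"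
proof -
  obtain \<phi> s where P: "\<And>e. e 0 = f (e 1) \<longleftrightarrow> sat (\<in>\<^sub>M) (join s e) \<phi>"
    using assms unfolding tdf_def dfn_def by auto
  \<comment> \<open>In a graph the value has index 0 and the argument index 1, while the replacement
    scheme has them the other way round; hence the swap.\<close>
  let ?h = "join (\<lambda>i. Suc (Suc (pr i))) (case_nat 1 (case_nat 0 (\<lambda>i. Suc (Suc (vr i)))))"
  let ?v = "\<lambda>n. case n of Suc (Suc m) \<Rightarrow> join s undefined m | _ \<Rightarrow> undefined"
  have inj: "inj ?h" by (intro inj_join) (auto simp: inj_on_def split: nat.splits)
  have *: "y = f x \<longleftrightarrow> sat (\<in>\<^sub>M) (?v(0 := x, 1 := y)) (ren ?h \<phi>)" for x y
  proof -
    have "(?v(0 := x, 1 := y) \<circ> ?h) n = join s (case_nat y (case_nat x undefined)) n" for n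
      by (rule vr_pr_cases[of n]) (auto split: nat.splits)
    then have "?v(0 := x, 1 := y) \<circ> ?h = join s (case_nat y (case_nat x undefined))" by blast
    then show ?thesis using P[of "case_nat y (case_nat x undefined)"] unfolding sat_ren[OF inj] by simp
  qed
  show ?thesis using replacement[of a ?v "ren ?h \<phi>"] unfolding *[symmetric] by blast
qed

lemma mem_Sep: "dfn1 P \<Longrightarrow> z \<in>\<^sub>M Sep A P \<longleftrightarrow> z \<in>\<^sub>M A \<and> P z"
  unfolding Sep_def by (rule mem_desc[OF separation_dfn])

lemma mem_Repl: "tdf1 f \<Longrightarrow> y \<in>\<^sub>M Repl A f \<longleftrightarrow> (\<exists>x. x \<in>\<^sub>M A \<and> y = f x)"
  unfolding Repl_def by (rule mem_desc[OF replacement_dfn])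

lemma mem_emp [simp]: "\<not> z \<in>\<^sub>M emp"
proof -
  obtain b where "\<forall>x. x \<in>\<^sub>M b \<longleftrightarrow> x \<in>\<^sub>M undefined \<and> False"
    using separation_dfn[of "\<lambda>_. False"] by (blast intro: dfn_intros)
  then have b: "\<not> nonempty b" by (simp add: nonempty_def)
  have "emp = b" unfolding emp_def
    by (rule desc_eq) (rule b, rule set_ext, use b in \<open>simp add: nonempty_def\<close>)
  then show ?thesis using b unfolding nonempty_def by blast
qed

lemma nonempty_iff: "nonempty x \<longleftrightarrow> x \<noteq> emp"
  using set_ext[of x emp] unfolding nonempty_def by auto

lemma mem_upair [simp]: "z \<in>\<^sub>M upair x y \<longleftrightarrow> z = x \<or> z = y"
  unfolding upair_def is_upair_def by (rule mem_desc) (use pairing in \<open>simp add: is_upair_def\<close>)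

lemma is_upair_iff: "is_upair z x y \<longleftrightarrow> z = upair x y"
  using set_ext[of z "upair x y"] by (auto simp: is_upair_def)

lemma mem_un [simp]: "z \<in>\<^sub>M un F \<longleftrightarrow> (\<exists>x. x \<in>\<^sub>M F \<and> z \<in>\<^sub>M x)"
  unfolding un_def is_union_def by (rule mem_desc) (use union in \<open>simp add: is_union_def\<close>)

lemma is_union_iff: "is_union u F \<longleftrightarrow> u = un F"
  using set_ext[of u "un F"] by (auto simp: is_union_def)

lemma mem_Pw [simp]: "z \<in>\<^sub>M Pw x \<longleftrightarrow> subset z x"
  unfolding Pw_def by (rule mem_desc) (use power_set in simp)

lemma mem_cup [simp]: "z \<in>\<^sub>M cup x y \<longleftrightarrow> z \<in>\<^sub>M x \<or> z \<in>\<^sub>M y"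
  by (auto simp: cup_def)

lemma mem_ins [simp]: "z \<in>\<^sub>M ins a x \<longleftrightarrow> z = a \<or> z \<in>\<^sub>M x"
  by (auto simp: ins_def)

lemma is_opair_iff: "is_opair z x y \<longleftrightarrow> z = upair (upair x x) (upair x y)"
  using set_ext[of z "upair (upair x x) (upair x y)"]
  by (auto simp: is_opair_def is_upair_iff)

lemma opair_eq: "opair x y = upair (upair x x) (upair x y)"
  unfolding opair_def is_opair_iff by (rule desc_eq) auto

lemma is_opair_iff': "is_opair z x y \<longleftrightarrow> z = opair x y"
  by (simp add: opair_eq is_opair_iff)

lemma upair_eq_iff: "upair a b = upair c d \<longleftrightarrow> a = c \<and> b = d \<or> a = d \<and> b = c"
proof
  assume "upair a b = upair c d"
  then have "\<And>z. z = a \<or> z = b \<longleftrightarrow> z = c \<or> z = d" by (metis mem_upair)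
  then show "a = c \<and> b = d \<or> a = d \<and> b = c" by metis
qed (auto intro: set_ext)

lemma opair_inject [simp]: "opair a b = opair c d \<longleftrightarrow> a = c \<and> b = d"
  unfolding opair_eq upair_eq_iff by auto

lemma rel_iff: "rel r x y \<longleftrightarrow> opair x y \<in>\<^sub>M r"
  by (auto simp: rel_def is_opair_iff')

lemma mem_prod: "z \<in>\<^sub>M prod A B \<longleftrightarrow> (\<exists>a b. z = opair a b \<and> a \<in>\<^sub>M A \<and> b \<in>\<^sub>M B)"
proof -
  have "y \<in>\<^sub>M Repl B (\<lambda>b. opair a b) \<longleftrightarrow> (\<exists>b. b \<in>\<^sub>M B \<and> y = opair a b)" for a y
    by (rule mem_Repl) (intro dfn_intros)
  moreover have "y \<in>\<^sub>M Repl A (\<lambda>a. Repl B (\<lambda>b. opair a b)) \<longleftrightarrow>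
    (\<exists>a. a \<in>\<^sub>M A \<and> y = Repl B (\<lambda>b. opair a b))" for y
    by (rule mem_Repl) (intro dfn_intros)
  ultimately show ?thesis unfolding prod_def by auto
qed

lemma opair_mem_prod [simp]: "opair a b \<in>\<^sub>M prod A B \<longleftrightarrow> a \<in>\<^sub>M A \<and> b \<in>\<^sub>M B"
  by (auto simp: mem_prod)

lemma subset_ext: "subset x y \<longleftrightarrow> ext x \<subseteq> ext y"
  by (auto simp: subset_def ext_def)

lemma subset_antisym: "subset x y \<Longrightarrow> subset y x \<Longrightarrow> x = y"
  using set_ext unfolding subset_def by blast

lemma mem_irrefl [simp]: "\<not> x \<in>\<^sub>M x"
  using foundation[of "upair x x"] by (auto simp: nonempty_def)

lemma mem_asym: "x \<in>\<^sub>M y \<Longrightarrow> \<not> y \<in>\<^sub>M x"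
  using foundation[of "upair x y"] by (auto simp: nonempty_def)

subsection \<open>Functions\<close>

lemma function_on_rel:
  assumes "function_on f a" shows "rel f x y \<longleftrightarrow> x \<in>\<^sub>M a \<and> y = app f x"
proof -
  have mem: "x \<in>\<^sub>M a" if "rel f x y" for y
    using assms that unfolding function_on_def rel_iff by (metis is_opair_iff' opair_inject)
  have unique: "\<exists>!y. rel f x y" if "x \<in>\<^sub>M a"
    using assms that unfolding function_on_def by blast
  have app: "rel f x (app f x)" if "x \<in>\<^sub>M a"
    unfolding app_def by (rule desc_sat[OF unique[OF that]])
  show ?thesis using mem unique app by blast
qed

lemma mem_lam: "tdf1 f \<Longrightarrow> z \<in>\<^sub>M lam a f \<longleftrightarrow> (\<exists>x. x \<in>\<^sub>M a \<and> z = opair x (f x))"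
  unfolding lam_def by (rule mem_Repl) (intro dfn_intros)

lemma rel_lam: "tdf1 f \<Longrightarrow> rel (lam a f) x y \<longleftrightarrow> x \<in>\<^sub>M a \<and> y = f x"
  by (auto simp: rel_iff mem_lam)

lemma function_on_lam: "tdf1 f \<Longrightarrow> function_on (lam a f) a"
  unfolding function_on_def is_opair_iff' by (auto simp: rel_lam mem_lam)

lemma app_lam: "tdf1 f \<Longrightarrow> x \<in>\<^sub>M a \<Longrightarrow> app (lam a f) x = f x"
  using function_on_rel[OF function_on_lam, of f a x "f x"] by (simp add: rel_lam)

text \<open>Moves from relations inside the model to HOL functions on extensions, where the library
  on \<open>inj_on\<close> and \<open>bij_betw\<close> applies.\<close>

lemma injection_iff:
  "injection f a b \<longleftrightarrow> function_on f a \<and> (\<forall>x. x \<in>\<^sub>M a \<longrightarrow> app f x \<in>\<^sub>M b) \<and> inj_on (app f) (ext a)"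
proof (cases "function_on f a")
  case True
  show ?thesis unfolding injection_def inj_on_def Ball_def function_on_rel[OF True] mem_ext by blast
qed (simp add: injection_def)

lemma bijection_iff: "bijection f a b \<longleftrightarrow> function_on f a \<and> bij_betw (app f) (ext a) (ext b)"
proof (cases "function_on f a")
  case True
  have "(\<forall>x. x \<in>\<^sub>M a \<longrightarrow> app f x \<in>\<^sub>M b) \<and> (\<forall>y. y \<in>\<^sub>M b \<longrightarrow> (\<exists>x. x \<in>\<^sub>M a \<and> y = app f x)) \<longleftrightarrow>
    app f ` ext a = ext b"
    unfolding set_eq_iff image_iff Bex_def mem_ext by blast
  then show ?thesis
    unfolding bijection_def injection_iff bij_betw_def function_on_rel[OF True] using True by blast
qed (simp add: bijection_def injection_def)

definition eqp :: "'a \<Rightarrow> 'a \<Rightarrow> bool" where "eqp x y \<longleftrightarrow> (\<exists>f. bijection f x y)"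

lemma dfn_eqp [dfn_intros]: "tdf t \<Longrightarrow> tdf u \<Longrightarrow> dfn (\<lambda>e. eqp (t e) (u e))"
  by (rule dfn_subst2) (unfold eqp_def; intro dfn_intros)

text \<open>Replacement turns the definable function into a set of pairs, namely
  \<open>lam a f\<close>. A bijection that exists only in HOL would not do: it need not correspond
  to any set of the model.\<close>

lemma eqpI:
  assumes "tdf1 f" "bij_betw f (ext a) (ext b)" shows "eqp a b"
proof -
  have "bij_betw (app (lam a f)) (ext a) (ext b)"
    using assms by (subst bij_betw_cong[of _ _ f]) (auto simp: app_lam)
  then show ?thesis unfolding eqp_def bijection_iff using function_on_lam[OF assms(1)] by blast
qed

lemma eqpE:
  assumes "eqp a b" obtains f where "tdf1 f" "bij_betw f (ext a) (ext b)"
proof -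
  obtain g where "bijection g a b" using assms unfolding eqp_def by auto
  then have "bij_betw (app g) (ext a) (ext b)" by (simp add: bijection_iff)
  moreover have "tdf1 (app g)" by (intro dfn_intros)
  ultimately show ?thesis using that by blast
qed

text \<open>HOL's \<open>inv_into\<close> rests on \<open>SOME\<close> and is not definable in
  general; a description of the preimage is.\<close>

lemma tdf_inv_into:
  assumes "tdf1 f"
  shows "tdf1 (\<lambda>y. desc (\<lambda>x. x \<in>\<^sub>M a \<and> f x = y))"
  by (intro dfn_intros tdf1_app[OF assms])

lemma eqp_sym: assumes "eqp a b" shows "eqp b a"
proof -
  obtain f where f: "tdf1 f" "bij_betw f (ext a) (ext b)" using eqpE[OF assms] .
  define g where "g = (\<lambda>y. desc (\<lambda>x. x \<in>\<^sub>M a \<and> f x = y))"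
  have g: "g (f x) = x" if "x \<in> ext a" for x
    unfolding g_def using f(2) that by (intro desc_eq) (auto simp: bij_betw_def inj_on_def)
  have b: "ext b = f ` ext a" using f(2) by (simp add: bij_betw_def)
  have "bij_betw g (ext b) (ext a)"
    unfolding b by (rule bij_betw_byWitness[where f' = f]) (auto simp: g[simplified])
  moreover have "tdf1 g" unfolding g_def by (rule tdf_inv_into[OF f(1)])
  ultimately show ?thesis by (rule eqpI[rotated])
qed

lemma eqp_trans: assumes "eqp a b" "eqp b c" shows "eqp a c"
proof -
  obtain f where f: "tdf1 f" "bij_betw f (ext a) (ext b)" using eqpE[OF assms(1)] .
  obtain g where g: "tdf1 g" "bij_betw g (ext b) (ext c)" using eqpE[OF assms(2)] .
  have "tdf1 (\<lambda>x. g (f x))" by (intro tdf1_app[OF g(1)] f(1))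
  moreover have "bij_betw (\<lambda>x. g (f x)) (ext a) (ext c)"
    using bij_betw_trans[OF f(2) g(2)] by (simp add: o_def)
  ultimately show ?thesis by (rule eqpI)
qed

lemma eqp_refl: "eqp a a"
  by (rule eqpI[of "\<lambda>x. x"]) (auto intro: dfn_intros simp: bij_betw_def)

subsection \<open>Natural numbers\<close>

lemma is_inductive_iff:
  "is_inductive x \<longleftrightarrow> emp \<in>\<^sub>M x \<and> (\<forall>y. y \<in>\<^sub>M x \<longrightarrow> ins y y \<in>\<^sub>M x)"
proof -
  have "\<not> nonempty z \<longleftrightarrow> z = emp" for z by (simp add: nonempty_iff)
  moreover have "is_succ s y \<longleftrightarrow> s = ins y y" for s y
    using set_ext[of s "ins y y"] by (auto simp: is_succ_def)
  ultimately show ?thesis unfolding is_inductive_def by auto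
qed

lemma is_omega_om: "is_omega om"
proof -
  obtain I where I: "is_inductive I" using infinity by blast
  define w where "w = Sep I (\<lambda>n. \<forall>J. is_inductive J \<longrightarrow> n \<in>\<^sub>M J)"
  have w: "n \<in>\<^sub>M w \<longleftrightarrow> n \<in>\<^sub>M I \<and> (\<forall>J. is_inductive J \<longrightarrow> n \<in>\<^sub>M J)" for n
    unfolding w_def by (rule mem_Sep) (intro dfn_intros)
  have "is_inductive w"
    unfolding is_inductive_iff[of w] w using I by (simp add: is_inductive_iff)
  then have w': "is_omega w" unfolding is_omega_def using w by (simp add: subset_def)
  have "x = w" if "is_omega x" for x
    by (rule subset_antisym) (use that w' in \<open>simp_all add: is_omega_def\<close>)
  with w' have "om = w" unfolding om_def by (intro desc_eq)
  then show ?thesis using w' by simp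
qed

lemma is_omega_iff: "is_omega w \<longleftrightarrow> w = om"
proof
  assume "is_omega w"
  then show "w = om"
    by (intro subset_antisym) (use is_omega_om in \<open>simp_all add: is_omega_def\<close>)
qed (simp add: is_omega_om)

lemma om_emp [simp]: "emp \<in>\<^sub>M om" and om_succ [simp]: "n \<in>\<^sub>M om \<Longrightarrow> ins n n \<in>\<^sub>M om"
  using is_omega_om unfolding is_omega_def is_inductive_iff by auto

text \<open>Definability of \<open>P\<close> is essential: if \<open>om\<close> has nonstandard
  elements, the standard ones contain zero and are closed under successor without being all of
  \<open>om\<close>.\<close>

lemma om_induct [consumes 2, case_names zero succ]:
  assumes n: "n \<in>\<^sub>M om" and P: "dfn1 P"
    and "P emp" "\<And>n. n \<in>\<^sub>M om \<Longrightarrow> P n \<Longrightarrow> P (ins n n)"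
  shows "P n"
proof -
  have "is_inductive (Sep om P)" unfolding is_inductive_iff mem_Sep[OF P] using assms by auto
  then have "subset om (Sep om P)" using is_omega_om unfolding is_omega_def by blast
  then show ?thesis using n unfolding subset_def mem_Sep[OF P] by blast
qed

lemma om_trans: assumes "n \<in>\<^sub>M om" "k \<in>\<^sub>M n" shows "k \<in>\<^sub>M om"
proof -
  have "dfn1 (\<lambda>n. \<forall>k. k \<in>\<^sub>M n \<longrightarrow> k \<in>\<^sub>M om)" by (intro dfn_intros)
  with assms(1) have "\<forall>k. k \<in>\<^sub>M n \<longrightarrow> k \<in>\<^sub>M om" by (induct rule: om_induct) auto
  with assms(2) show ?thesis by blast
qed

lemma om_mem_trans: assumes "n \<in>\<^sub>M om" "k \<in>\<^sub>M n" "m \<in>\<^sub>M k" shows "m \<in>\<^sub>M n"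
proof -
  have "dfn1 (\<lambda>n. \<forall>k. k \<in>\<^sub>M n \<longrightarrow> (\<forall>m. m \<in>\<^sub>M k \<longrightarrow> m \<in>\<^sub>M n))" by (intro dfn_intros)
  with assms(1) have "\<forall>k. k \<in>\<^sub>M n \<longrightarrow> (\<forall>m. m \<in>\<^sub>M k \<longrightarrow> m \<in>\<^sub>M n)"
    by (induct rule: om_induct) auto
  with assms(2,3) show ?thesis by blast
qed

lemma succ_inject [simp]: "ins m m = ins n n \<longleftrightarrow> m = n"
  by (metis mem_ins mem_asym)

lemma om_emp_mem: assumes "n \<in>\<^sub>M om" shows "n = emp \<or> emp \<in>\<^sub>M n"
proof -
  have "dfn1 (\<lambda>n. n = emp \<or> emp \<in>\<^sub>M n)" by (intro dfn_intros)
  with assms show ?thesis by (induct rule: om_induct) auto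
qed

lemma om_succ_mono: assumes "n \<in>\<^sub>M om" "m \<in>\<^sub>M n" shows "ins m m \<in>\<^sub>M ins n n"
proof -
  have "dfn1 (\<lambda>n. \<forall>m. m \<in>\<^sub>M n \<longrightarrow> ins m m \<in>\<^sub>M ins n n)" by (intro dfn_intros)
  with assms(1) have "\<forall>m. m \<in>\<^sub>M n \<longrightarrow> ins m m \<in>\<^sub>M ins n n" by (induct rule: om_induct) auto
  with assms(2) show ?thesis by blast
qed

lemma om_linear: assumes "n \<in>\<^sub>M om" "m \<in>\<^sub>M om" shows "m \<in>\<^sub>M n \<or> m = n \<or> n \<in>\<^sub>M m"
proof -
  have "dfn1 (\<lambda>n. \<forall>m. m \<in>\<^sub>M om \<longrightarrow> m \<in>\<^sub>M n \<or> m = n \<or> n \<in>\<^sub>M m)" by (intro dfn_intros)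
  with assms(1) have "\<forall>m. m \<in>\<^sub>M om \<longrightarrow> m \<in>\<^sub>M n \<or> m = n \<or> n \<in>\<^sub>M m"
  proof (induct rule: om_induct)
    case zero then show ?case using om_emp_mem by blast
  next
    case (succ n)
    then show ?case using om_succ_mono[of _ n] by (metis mem_ins)
  qed
  with assms(2) show ?thesis by blast
qed

lemma om_subset_iff:
  assumes "n \<in>\<^sub>M om" "m \<in>\<^sub>M om" shows "subset m n \<longleftrightarrow> m \<in>\<^sub>M n \<or> m = n"
  using om_linear[OF assms] om_mem_trans[OF assms(1)] unfolding subset_def by (metis mem_irrefl)

text \<open>Foundation gives a minimal element for membership, and linearity makes it least.\<close>

lemma om_least:
  assumes P: "dfn1 P" and "n \<in>\<^sub>M om" "P n"
  obtains m where "m \<in>\<^sub>M om" "P m" "\<And>k. k \<in>\<^sub>M om \<Longrightarrow> P k \<Longrightarrow> m \<in>\<^sub>M k \<or> m = k"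
proof -
  have "nonempty (Sep om P)" unfolding nonempty_def mem_Sep[OF P] using assms by blast
  from foundation[OF this] show ?thesis
    unfolding mem_Sep[OF P] using that om_linear by metis
qed

text \<open>The definable substitute for HOL's \<open>LEAST\<close>, and the only source of
  selections that need no choice principle.\<close>

definition least :: "('a \<Rightarrow> bool) \<Rightarrow> 'a" where
  "least P = desc (\<lambda>n. n \<in>\<^sub>M om \<and> P n \<and> (\<forall>k. k \<in>\<^sub>M om \<longrightarrow> P k \<longrightarrow> n \<in>\<^sub>M k \<or> n = k))"

lemma tdf_least [dfn_intros]:
  assumes "dfn (\<lambda>e. P (\<lambda>i. e (Suc i)) (e 0))" shows "tdf (\<lambda>e. least (P e))"
  unfolding least_def
  by (intro dfn_intros assms dfn_under[of P] dfn_under[of "\<lambda>e. P (\<lambda>i. e (Suc i))"])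

lemma least:
  assumes P: "dfn1 P" and "n \<in>\<^sub>M om" "P n"
  shows "least P \<in>\<^sub>M om" "P (least P)" "least P \<in>\<^sub>M n \<or> least P = n"
proof -
  obtain m where m: "m \<in>\<^sub>M om" "P m" "\<And>k. k \<in>\<^sub>M om \<Longrightarrow> P k \<Longrightarrow> m \<in>\<^sub>M k \<or> m = k"
    using om_least[of P n] assms by metis
  have "least P = m" unfolding least_def
    by (rule desc_eq) (use m mem_asym in blast)+
  then show "least P \<in>\<^sub>M om" "P (least P)" "least P \<in>\<^sub>M n \<or> least P = n" using m assms by auto
qed

subsection \<open>Finite sets\<close>

lemma finite_iff: "finite_set x \<longleftrightarrow> (\<exists>n. n \<in>\<^sub>M om \<and> eqp x n)"
  by (auto simp: finite_set_def is_omega_iff eqp_def)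

lemma finite_eqp: "eqp x y \<Longrightarrow> finite_set y \<Longrightarrow> finite_set x"
  unfolding finite_iff using eqp_trans by blast

lemma finite_om: "n \<in>\<^sub>M om \<Longrightarrow> finite_set n"
  unfolding finite_iff using eqp_refl by blast

lemma finite_emp [simp]: "finite_set emp"
  using finite_om om_emp by blast

lemma eqp_ins:
  assumes "eqp x n" "\<not> a \<in>\<^sub>M x" shows "eqp (ins a x) (ins n n)"
proof -
  obtain f where f: "tdf1 f" "bij_betw f (ext x) (ext n)" using eqpE[OF assms(1)] .
  let ?g = "\<lambda>z. if z = a then n else f z"
  have "tdf1 ?g" by (intro dfn_intros f)
  moreover have "bij_betw ?g (ext (ins a x)) (ext (ins n n))"
  proof -
    have "bij_betw ?g (ext x) (ext n)"
      using f(2) assms(2) by (subst bij_betw_cong[of _ _ f]) auto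
    then have "bij_betw ?g (ext x \<union> {a}) (ext n \<union> {?g a})"
      using assms(2) by (intro notIn_Un_bij_betw) auto
    moreover have "ext x \<union> {a} = ext (ins a x)" "ext n \<union> {?g a} = ext (ins n n)" by auto
    ultimately show ?thesis by (simp only:)
  qed
  ultimately show ?thesis by (rule eqpI)
qed

lemma finite_ins: assumes "finite_set x" shows "finite_set (ins a x)"
proof (cases "a \<in>\<^sub>M x")
  case True
  then have "ins a x = x" by (intro set_ext) auto
  then show ?thesis using assms by simp
next
  case False
  then show ?thesis using assms eqp_ins om_succ unfolding finite_iff by blast
qed

text \<open>Induction on the cardinality \<open>n\<close> inside the model, for all sets
  equinumerous with \<open>n\<close> at once, which keeps the statement first-order. The successor
  step removes the element that the bijection sends to the last number \<open>n\<close>.\<close>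

lemma finite_induct [consumes 2, case_names empty ins]:
  assumes x: "finite_set x" and P: "dfn1 P"
    and emp: "P emp" and ins: "\<And>a y. finite_set y \<Longrightarrow> \<not> a \<in>\<^sub>M y \<Longrightarrow> P y \<Longrightarrow> P (ins a y)"
  shows "P x"
proof -
  obtain n where n: "n \<in>\<^sub>M om" "eqp x n" using x unfolding finite_iff by auto
  have "dfn1 (\<lambda>n. \<forall>x. eqp x n \<longrightarrow> P x)" by (intro dfn_intros dfn1_app[OF P])
  with n(1) have "\<forall>x. eqp x n \<longrightarrow> P x"
  proof (induct rule: om_induct)
    case zero
    have "x = emp" if "eqp x emp" for x
      using eqpE[OF that] by (metis bij_betwE mem_emp mem_ext set_ext)
    then show ?case using emp by blast
  next
    case (succ n)
    show ?case
    proof (intro allI impI)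
      fix x assume "eqp x (ins n n)"
      then obtain f where f: "tdf1 f" "bij_betw f (ext x) (ext (ins n n))" using eqpE by blast
      have "n \<in> f ` ext x" using f(2) unfolding bij_betw_def by simp
      then obtain a where a: "a \<in>\<^sub>M x" "f a = n" by auto
      define y where "y = Sep x (\<lambda>z. z \<noteq> a)"
      have y: "z \<in>\<^sub>M y \<longleftrightarrow> z \<in>\<^sub>M x \<and> z \<noteq> a" for z
        unfolding y_def by (rule mem_Sep) (intro dfn_intros)
      have "bij_betw f (ext x - {a}) (ext (ins n n) - {n})"
        using bij_betw_DiffI[OF f(2), of "{a}" "{n}"] a by auto
      moreover have "ext x - {a} = ext y" by (auto simp: y)
      moreover have "ext (ins n n) - {n} = ext n" by auto
      ultimately have "eqp y n" by (intro eqpI[OF f(1)]) (simp only:)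
      moreover have "ins a y = x" using a y by (intro set_ext) auto
      ultimately show "P x"
        using succ ins[of y a] finite_iff y by auto
    qed
  qed
  then show ?thesis using n by blast
qed

lemma finite_subset: assumes "finite_set x" "subset y x" shows "finite_set y"
proof -
  have "dfn1 (\<lambda>x. \<forall>y. subset y x \<longrightarrow> finite_set y)" by (intro dfn_intros)
  with assms(1) have "\<forall>y. subset y x \<longrightarrow> finite_set y"
  proof (induct rule: finite_induct)
    case empty
    have "y = emp" if "subset y emp" for y using that by (intro set_ext) (auto simp: subset_def)
    then show ?case using finite_emp by metis
  next
    case (ins a x)
    show ?case
    proof (intro allI impI)
      fix y assume *: "subset y (ins a x)"
      define z where "z = Sep y (\<lambda>b. b \<noteq> a)"
      have z: "b \<in>\<^sub>M z \<longleftrightarrow> b \<in>\<^sub>M y \<and> b \<noteq> a" for b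
        unfolding z_def by (rule mem_Sep) (intro dfn_intros)
      have "finite_set z" using ins * z by (auto simp: subset_def)
      moreover have "y = (if a \<in>\<^sub>M y then ins a z else z)" using z by (intro set_ext) auto
      ultimately show "finite_set y" using finite_ins by metis
    qed
  qed
  then show ?thesis using assms by blast
qed

lemma finite_cup: assumes "finite_set x" "finite_set y" shows "finite_set (cup x y)"
proof -
  have "dfn1 (\<lambda>x. finite_set (cup x y))" by (intro dfn_intros)
  with assms(1) show ?thesis
  proof (induct rule: finite_induct)
    case empty
    have "cup emp y = y" by (intro set_ext) auto
    then show ?case using assms by simp
  next
    case (ins a x)
    have "cup (ins a x) y = ins a (cup x y)" by (intro set_ext) auto
    then show ?case using ins finite_ins by simp
  qed
qed

lemma finite_UN:
  assumes I: "finite_set I" and g: "tdf1 g" and fin: "\<And>i. i \<in>\<^sub>M I \<Longrightarrow> finite_set (g i)"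
  shows "finite_set (un (Repl I g))"
proof -
  \<comment> \<open>The induction runs over subsets of \<open>I\<close>, since \<open>g\<close> is
    known to have finite values only there.\<close>
  have "dfn1 (\<lambda>J. subset J I \<longrightarrow> finite_set (un (Repl J g)))"
    by (intro dfn_intros tdf1_app[OF g])
  with I have "subset I I \<longrightarrow> finite_set (un (Repl I g))"
  proof (induct rule: finite_induct)
    case empty
    have "un (Repl emp g) = emp" by (intro set_ext) (auto simp: mem_Repl[OF g])
    then show ?case by simp
  next
    case (ins a J)
    have "un (Repl (ins a J) g) = cup (g a) (un (Repl J g))"
      by (intro set_ext) (auto simp: mem_Repl[OF g])
    then show ?case using ins finite_cup fin by (auto simp: subset_def)
  qed
  then show ?thesis by (simp add: subset_def)
qed

lemma finite_Repl:
  assumes "finite_set I" and g: "tdf1 g" shows "finite_set (Repl I g)"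
proof -
  have h: "tdf1 (\<lambda>i. ins (g i) emp)" by (intro dfn_intros g)
  have "Repl I g = un (Repl I (\<lambda>i. ins (g i) emp))"
    by (intro set_ext) (auto simp: mem_Repl[OF g] mem_Repl[OF h])
  then show ?thesis using finite_UN[OF assms(1) h] finite_ins[OF finite_emp] by simp
qed

lemma finite_prod: assumes "finite_set x" "finite_set y" shows "finite_set (prod x y)"
  unfolding prod_def
  by (rule finite_UN[OF assms(1)]) (intro dfn_intros finite_Repl assms)+

lemma finite_Pw: assumes "finite_set x" shows "finite_set (Pw x)"
proof -
  have "dfn1 (\<lambda>x. finite_set (Pw x))" by (intro dfn_intros)
  with assms show ?thesis
  proof (induct rule: finite_induct)
    case empty
    have "Pw emp = ins emp emp"
      by (intro set_ext) (auto simp: subset_def intro: set_ext)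
    then show ?case using finite_ins by simp
  next
    case (ins a x)
    have h: "tdf1 (\<lambda>y. ins a y)" by (intro dfn_intros)
    have "Pw (ins a x) = cup (Pw x) (Repl (Pw x) (\<lambda>y. ins a y))"
    proof (intro set_ext)
      fix z
      have "\<exists>y. subset y x \<and> z = ins a y" if "subset z (ins a x)" "a \<in>\<^sub>M z"
      proof -
        have "b \<in>\<^sub>M Sep z (\<lambda>b. b \<noteq> a) \<longleftrightarrow> b \<in>\<^sub>M z \<and> b \<noteq> a" for b
          by (rule mem_Sep) (intro dfn_intros)
        then show ?thesis
          using that by (intro exI[of _ "Sep z (\<lambda>b. b \<noteq> a)"]) (auto simp: subset_def intro: set_ext)
      qed
      then show "z \<in>\<^sub>M Pw (ins a x) \<longleftrightarrow> z \<in>\<^sub>M cup (Pw x) (Repl (Pw x) (\<lambda>y. ins a y))"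
        by (auto simp: mem_Repl[OF h] subset_def)
    qed
    then show ?case using ins finite_cup finite_Repl[OF _ h] by simp
  qed
qed

lemma finite_inj:
  assumes f: "tdf1 f" "inj_on f (ext x)" and "\<And>z. z \<in>\<^sub>M x \<Longrightarrow> f z \<in>\<^sub>M y" "finite_set y"
  shows "finite_set x"
proof -
  have "finite_set (Repl x f)"
    by (rule finite_subset[OF assms(4)]) (use assms(3) in \<open>auto simp: subset_def mem_Repl[OF f(1)]\<close>)
  moreover have "bij_betw f (ext x) (ext (Repl x f))"
    using f(2) by (auto simp: bij_betw_def mem_Repl[OF f(1)])
  ultimately show ?thesis using finite_eqp eqpI[OF f(1)] by blast
qed

text \<open>The step turns an injection of \<open>n + 1\<close> into one of \<open>n\<close> by redirecting the preimage of \<open>n\<close> to \<open>f n\<close>.\<close>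

lemma om_pigeonhole:
  assumes n: "n \<in>\<^sub>M om" and f: "tdf1 f" "\<And>x. x \<in>\<^sub>M n \<Longrightarrow> f x \<in>\<^sub>M n" "inj_on f (ext n)" and y: "y \<in>\<^sub>M n"
  shows "\<exists>x. x \<in>\<^sub>M n \<and> f x = y"
proof -
  \<comment> \<open>A formula cannot quantify over definable functions, so the induction ranges over
    sets \<open>f\<close> used through \<open>app\<close>. The given function enters at the end as
    \<open>lam n f\<close>.\<close>
  let ?P = "\<lambda>n. \<forall>f. (\<forall>x. x \<in>\<^sub>M n \<longrightarrow> app f x \<in>\<^sub>M n) \<and>
      (\<forall>x x'. x \<in>\<^sub>M n \<and> x' \<in>\<^sub>M n \<and> app f x = app f x' \<longrightarrow> x = x') \<longrightarrow>
      (\<forall>y. y \<in>\<^sub>M n \<longrightarrow> (\<exists>x. x \<in>\<^sub>M n \<and> app f x = y))"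
  have "dfn1 ?P" by (intro dfn_intros)
  with n have "?P n"
  proof (induct rule: om_induct)
    case zero then show ?case by simp
  next
    case (succ n)
    show ?case
    proof (intro allI impI, elim conjE)
      fix f y
      assume f1: "\<forall>x. x \<in>\<^sub>M ins n n \<longrightarrow> app f x \<in>\<^sub>M ins n n"
        and f2: "\<forall>x x'. x \<in>\<^sub>M ins n n \<and> x' \<in>\<^sub>M ins n n \<and> app f x = app f x' \<longrightarrow> x = x'"
        and y: "y \<in>\<^sub>M ins n n"
      define g where "g = lam n (\<lambda>x. if app f x = n then app f n else app f x)"
      have g: "app g x = (if app f x = n then app f n else app f x)" if "x \<in>\<^sub>M n" for x
        unfolding g_def by (rule app_lam[OF _ that]) (intro dfn_intros)
      have le: "app f x \<in>\<^sub>M n \<or> app f x = n" if "x \<in>\<^sub>M n \<or> x = n" for x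
        using f1 that unfolding mem_ins by blast
      have eq: "x = x'" if "x \<in>\<^sub>M n \<or> x = n" "x' \<in>\<^sub>M n \<or> x' = n" "app f x = app f x'" for x x'
        using f2 that unfolding mem_ins by blast
      have hit: "app f n \<in>\<^sub>M n" if "x \<in>\<^sub>M n" "app f x = n" for x
        using le[of n] eq[of x n] that by auto
      have "app g x \<in>\<^sub>M n" if "x \<in>\<^sub>M n" for x
        using le[of x] hit[of x] that by (auto simp: g)
      moreover have "x = x'" if "x \<in>\<^sub>M n" "x' \<in>\<^sub>M n" "app g x = app g x'" for x x'
      proof -
        have "x \<noteq> n" "x' \<noteq> n" using that by auto
        then show ?thesis
          using that(3) eq[of x x'] eq[of n x'] eq[of x n] that(1,2)
          unfolding g[OF that(1)] g[OF that(2)] by (cases "app f x = n"; cases "app f x' = n") simp_all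
      qed
      ultimately have surj: "\<And>y. y \<in>\<^sub>M n \<Longrightarrow> \<exists>x. x \<in>\<^sub>M n \<and> app g x = y"
        using spec[OF succ(2), of g] by blast
      show "\<exists>x. x \<in>\<^sub>M ins n n \<and> app f x = y"
      proof (cases "y = n")
        case False
        then obtain x where "x \<in>\<^sub>M n" "app g x = y" using surj y by auto
        then have "app f x = y \<or> app f n = y" by (auto simp: g split: if_splits)
        then show ?thesis using \<open>x \<in>\<^sub>M n\<close> by auto
      next
        case True
        show ?thesis
        proof (rule ccontr)
          assume "\<not> ?thesis"
          then have no: "app f x \<noteq> n" if "x \<in>\<^sub>M n \<or> x = n" for x using True that by auto
          then have "app f n \<in>\<^sub>M n" using le[of n] by auto
          then obtain x where x: "x \<in>\<^sub>M n" "app g x = app f n" using surj by blast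
          then have "x = n" using no eq[of x n] by (auto simp: g)
          then show False using x by simp
        qed
      qed
    qed
  qed
  from spec[OF this, of "lam n f"]
  have "(\<forall>x. x \<in>\<^sub>M n \<longrightarrow> f x \<in>\<^sub>M n) \<and> (\<forall>x x'. x \<in>\<^sub>M n \<and> x' \<in>\<^sub>M n \<and> f x = f x' \<longrightarrow> x = x') \<longrightarrow>
      (\<forall>y. y \<in>\<^sub>M n \<longrightarrow> (\<exists>x. x \<in>\<^sub>M n \<and> f x = y))"
    by (simp add: app_lam[OF f(1)] cong: conj_cong)
  then show ?thesis using f(2) inj_onD[OF f(3)] y by simp
qed

text \<open>Conjugated by bijections with \<open>n\<close>, the map from \<open>x\<close> onto
  \<open>y\<close> becomes an injection of \<open>n\<close> into itself. The pigeonhole principle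
  makes it surjective, and so every element of \<open>x\<close> is a value of
  \<open>f\<close>.\<close>

lemma dedekind:
  assumes "finite_set x" "eqp x y" "subset y x" shows "y = x"
proof -
  obtain n where n: "n \<in>\<^sub>M om" "eqp x n" using assms unfolding finite_iff by auto
  obtain h where h: "tdf1 h" "bij_betw h (ext x) (ext n)" using eqpE[OF n(2)] .
  obtain k where k: "tdf1 k" "bij_betw k (ext n) (ext x)" using eqpE[OF eqp_sym[OF n(2)]] .
  obtain f where f: "tdf1 f" "bij_betw f (ext x) (ext y)" using eqpE[OF assms(2)] .
  let ?g = "\<lambda>m. h (f (k m))"
  have g: "tdf1 ?g" by (intro tdf1_app[OF h(1)] tdf1_app[OF f(1)] k(1))
  have yx: "z \<in>\<^sub>M y \<Longrightarrow> z \<in>\<^sub>M x" for z using assms(3) by (auto simp: subset_def)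
  have k': "k m \<in>\<^sub>M x" if "m \<in>\<^sub>M n" for m using bij_betwE[OF k(2)] that by simp
  have f': "f z \<in>\<^sub>M y" if "z \<in>\<^sub>M x" for z using bij_betwE[OF f(2)] that by simp
  have h': "h z \<in>\<^sub>M n" if "z \<in>\<^sub>M x" for z using bij_betwE[OF h(2)] that by simp
  have h_eq: "z = z'" if "h z = h z'" "z \<in>\<^sub>M x" "z' \<in>\<^sub>M x" for z z'
    using inj_onD[OF bij_betw_imp_inj_on[OF h(2)], of z z'] that by simp
  have f_eq: "z = z'" if "f z = f z'" "z \<in>\<^sub>M x" "z' \<in>\<^sub>M x" for z z'
    using inj_onD[OF bij_betw_imp_inj_on[OF f(2)], of z z'] that by simp
  have k_eq: "m = m'" if "k m = k m'" "m \<in>\<^sub>M n" "m' \<in>\<^sub>M n" for m m'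
    using inj_onD[OF bij_betw_imp_inj_on[OF k(2)], of m m'] that by simp
  have inj: "inj_on ?g (ext n)"
    by (rule inj_onI, rule k_eq, rule f_eq, rule h_eq) (auto intro: yx f' k')
  have "z \<in>\<^sub>M y" if z: "z \<in>\<^sub>M x" for z
  proof -
    obtain m where m: "m \<in>\<^sub>M n" "?g m = h z"
      using om_pigeonhole[OF n(1) g _ inj h'[OF z]] h' yx f' k' by blast
    then have "f (k m) = z" using h_eq yx f' k' z by blast
    then show ?thesis using f'[OF k'[OF m(1)]] by simp
  qed
  then show ?thesis using yx by (intro set_ext) blast
qed

section \<open>Cardinalities of finite sets\<close>

definition card :: "'a \<Rightarrow> 'a" where "card x = desc (\<lambda>n. n \<in>\<^sub>M om \<and> eqp x n)"

lemma tdf_card [dfn_intros]: "tdf t \<Longrightarrow> tdf (\<lambda>e. card (t e))"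
  by (rule tdf_subst1) (unfold card_def; intro dfn_intros)

lemma om_eqp_eq: assumes "n \<in>\<^sub>M om" "m \<in>\<^sub>M om" "eqp n m" shows "n = m"
proof -
  have "subset n m \<or> subset m n" using om_subset_iff om_linear assms(1,2) by metis
  then show ?thesis using dedekind finite_om assms eqp_sym by metis
qed

lemma card_eqI: "n \<in>\<^sub>M om \<Longrightarrow> eqp x n \<Longrightarrow> card x = n"
  unfolding card_def by (rule desc_eq) (use om_eqp_eq eqp_trans eqp_sym in blast)+

lemma card: assumes "finite_set x" shows "card x \<in>\<^sub>M om" "eqp x (card x)"
  using assms card_eqI unfolding finite_iff by auto

lemma card_psubset:
  assumes "finite_set x" "subset y x" "card y = card x" shows "y = x"
  using assms card[of x] card[of y] finite_subset eqp_trans eqp_sym dedekind by metis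

lemma card_ins:
  assumes "finite_set x" "\<not> a \<in>\<^sub>M x" shows "card (ins a x) = ins (card x) (card x)"
  using card_eqI[OF om_succ eqp_ins] card assms by blast

lemma card_eq_empD: assumes "finite_set x" "card x = emp" shows "x = emp"
proof -
  have "eqp x emp" using card(2)[OF assms(1)] assms(2) by simp
  then obtain f where "bij_betw f (ext x) (ext emp)" using eqpE by blast
  then show ?thesis by (intro set_ext) (auto dest!: bij_betwE)
qed

text \<open>Otherwise \<open>card x\<close> would be an element of \<open>card y\<close>, and the
  first \<open>card x\<close> elements in an enumeration of \<open>y\<close> would form a subset of
  \<open>x\<close> equinumerous with \<open>x\<close>. By \<open>dedekind\<close> that subset is all
  of \<open>x\<close>, so \<open>y = x\<close>, which is absurd.\<close>

lemma card_mono: assumes "finite_set x" "subset y x" shows "subset (card y) (card x)"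
proof (rule ccontr)
  assume not: "\<not> subset (card y) (card x)"
  have y: "finite_set y" using finite_subset assms .
  have in_y: "card x \<in>\<^sub>M card y" and sub: "subset (card x) (card y)"
    using not om_linear om_subset_iff card(1) y assms(1) by metis+
  obtain g where g: "tdf1 g" "bij_betw g (ext (card y)) (ext y)" using eqpE[OF eqp_sym[OF card(2)[OF y]]] .
  have z: "v \<in>\<^sub>M Repl (card x) g \<longleftrightarrow> (\<exists>w. w \<in>\<^sub>M card x \<and> v = g w)" for v by (rule mem_Repl[OF g(1)])
  have zy: "subset (Repl (card x) g) y"
    using bij_betwE[OF g(2)] sub by (auto simp: subset_def z)
  have "bij_betw g (ext (card x)) (ext (Repl (card x) g))"
    by (rule bij_betw_subset[OF g(2)]) (use sub in \<open>auto simp: subset_ext z\<close>)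
  then have "eqp x (Repl (card x) g)" using eqp_trans[OF card(2)[OF assms(1)] eqpI[OF g(1)]] by blast
  moreover have "subset (Repl (card x) g) x" using zy assms(2) by (simp add: subset_def)
  ultimately have "Repl (card x) g = x" using dedekind assms(1) by blast
  then have "y = x" using zy assms(2) subset_antisym by metis
  then show False using in_y by simp
qed

text \<open>A finite \<open>om\<close> would be equinumerous with one of its elements, which is also
  a subset; \<open>dedekind\<close> would make the two equal.\<close>

lemma infinite_om: "\<not> finite_set om"
proof
  assume "finite_set om"
  then obtain n where n: "n \<in>\<^sub>M om" "eqp om n" unfolding finite_iff by auto
  have "subset n om" using om_trans n by (auto simp: subset_def)
  then have "n = om" using dedekind \<open>finite_set om\<close> n by blast
  then show False using n by auto
qed

subsection \<open>Countable sets\<close>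

lemma countableI:
  assumes "tdf1 f" "inj_on f (ext a)" "\<And>x. x \<in>\<^sub>M a \<Longrightarrow> f x \<in>\<^sub>M om"
  shows "countable_set a"
proof -
  have "inj_on (app (lam a f)) (ext a)"
    using assms by (subst inj_on_cong[of _ _ f]) (auto simp: app_lam)
  then have "injection (lam a f) a om"
    unfolding injection_iff using assms function_on_lam by (simp add: app_lam)
  then show ?thesis unfolding countable_set_def using is_omega_om by blast
qed

lemma countableE:
  assumes "countable_set a"
  obtains f where "tdf1 f" "inj_on f (ext a)" "\<And>x. x \<in>\<^sub>M a \<Longrightarrow> f x \<in>\<^sub>M om"
proof -
  obtain g where "injection g a om" using assms unfolding countable_set_def is_omega_iff by auto
  then have "inj_on (app g) (ext a)" "\<And>x. x \<in>\<^sub>M a \<Longrightarrow> app g x \<in>\<^sub>M om" by (simp_all add: injection_iff)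
  moreover have "tdf1 (app g)" by (intro dfn_intros)
  ultimately show ?thesis using that by blast
qed

lemma countable_om: "countable_set om"
  by (rule countableI[of "\<lambda>x. x"]) (auto intro: dfn_intros)

text \<open>A preimage cannot be chosen, but the least code of a preimage is definable, and it
  determines the image.\<close>

lemma countable_Repl:
  assumes "countable_set A" and g: "tdf1 g" shows "countable_set (Repl A g)"
proof -
  obtain f where f: "tdf1 f" "inj_on f (ext A)" "\<And>x. x \<in>\<^sub>M A \<Longrightarrow> f x \<in>\<^sub>M om"
    using countableE[OF assms(1)] by metis
  define P where "P y n \<longleftrightarrow> (\<exists>x. x \<in>\<^sub>M A \<and> g x = y \<and> f x = n)" for y n
  have P: "dfn1 (P y)" for y
    unfolding P_def by (intro dfn_intros tdf1_app[OF g] tdf1_app[OF f(1)])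
  have h: "tdf1 (\<lambda>y. least (P y))"
    unfolding P_def by (intro dfn_intros tdf1_app[OF g] tdf1_app[OF f(1)])
  have least_P: "least (P y) \<in>\<^sub>M om" "P y (least (P y))" if y: "y \<in>\<^sub>M Repl A g" for y
  proof -
    obtain x where x: "x \<in>\<^sub>M A" "y = g x" using y by (auto simp: mem_Repl[OF g])
    then have "f x \<in>\<^sub>M om" "P y (f x)" using f(3) by (auto simp: P_def)
    then show "least (P y) \<in>\<^sub>M om" "P y (least (P y))" using least[OF P] by blast+
  qed
  show ?thesis
  proof (rule countableI[OF h _ least_P(1)])
    show "inj_on (\<lambda>y. least (P y)) (ext (Repl A g))"
    proof (rule inj_onI, unfold mem_ext)
      fix y y' assume "y \<in>\<^sub>M Repl A g" "y' \<in>\<^sub>M Repl A g" and eq: "least (P y) = least (P y')"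
      with least_P(2) have "P y (least (P y))" "P y' (least (P y))" by metis+
      then obtain x x' where "x \<in>\<^sub>M A" "x' \<in>\<^sub>M A" "g x = y" "g x' = y'" "f x = f x'"
        unfolding P_def by auto
      then show "y = y'" using inj_onD[OF f(2), of x x'] by auto
    qed
  qed
qed

text \<open>If \<open>lt x y\<close>, then \<open>x\<close> lies in the segment below
  \<open>y\<close> but not in the one below \<open>x\<close>, and a proper subset of a finite set
  has another cardinality. This replaces a pairing function on \<open>om\<close>, which would
  require arithmetic in the model.\<close>

lemma countable_order:
  assumes lt: "dfn2 lt"
    and irrefl: "\<And>x. x \<in>\<^sub>M u \<Longrightarrow> \<not> lt x x"
    and trans: "\<And>x y z. x \<in>\<^sub>M u \<Longrightarrow> y \<in>\<^sub>M u \<Longrightarrow> z \<in>\<^sub>M u \<Longrightarrow> lt x y \<Longrightarrow> lt y z \<Longrightarrow> lt x z"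
    and total: "\<And>x y. x \<in>\<^sub>M u \<Longrightarrow> y \<in>\<^sub>M u \<Longrightarrow> x \<noteq> y \<Longrightarrow> lt x y \<or> lt y x"
    and fin: "\<And>y. y \<in>\<^sub>M u \<Longrightarrow> finite_set (Sep u (\<lambda>x. lt x y))"
  shows "countable_set u"
proof -
  define D where "D y = Sep u (\<lambda>x. lt x y)" for y
  have D: "x \<in>\<^sub>M D y \<longleftrightarrow> x \<in>\<^sub>M u \<and> lt x y" for x y
    unfolding D_def by (rule mem_Sep) (intro dfn2_app[OF lt] dfn_intros)
  have fin: "finite_set (D y)" if "y \<in>\<^sub>M u" for y using fin[OF that] by (simp add: D_def)
  have neq: "card (D x) \<noteq> card (D y)" if "x \<in>\<^sub>M u" "y \<in>\<^sub>M u" "lt x y" for x y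
  proof
    assume eq: "card (D x) = card (D y)"
    have "subset (D x) (D y)" using trans[OF _ that(1,2) _ that(3)] unfolding subset_def D by blast
    then have "D x = D y" using card_psubset[OF fin[OF that(2)] _ eq] by blast
    then have "x \<in>\<^sub>M D x" using that by (simp add: D)
    then show False using irrefl that by (simp add: D)
  qed
  show ?thesis
  proof (rule countableI[of "\<lambda>y. card (D y)"])
    show "tdf1 (\<lambda>y. card (D y))" unfolding D_def by (intro dfn_intros lt)
    show "inj_on (\<lambda>y. card (D y)) (ext u)"
    proof (rule inj_onI, unfold mem_ext)
      fix x y assume "x \<in>\<^sub>M u" "y \<in>\<^sub>M u" "card (D x) = card (D y)"
      then show "x = y" using neq[of x y] neq[of y x] total[of x y] by auto
    qed
    show "card (D y) \<in>\<^sub>M om" if "y \<in>\<^sub>M u" for y using card(1) fin that by blast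
  qed
qed

subsection \<open>Countable choice implies that unions are countable\<close>

text \<open>Bounds all injections from \<open>a\<close> into \<open>b\<close> by one power set, so
  that they form a set, finite when \<open>a\<close> and \<open>b\<close> are.\<close>

lemma injection_subset_prod: "injection f a b \<Longrightarrow> subset f (prod a b)"
proof -
  assume f: "injection f a b"
  show ?thesis unfolding subset_def
  proof (intro allI impI)
    fix p assume p: "p \<in>\<^sub>M f"
    then obtain x y where "p = opair x y" "x \<in>\<^sub>M a"
      using f unfolding injection_def function_on_def is_opair_iff' by blast
    then show "p \<in>\<^sub>M prod a b" using f p unfolding injection_def rel_iff by auto
  qed
qed

lemma choice_imp_unions_countable:
  assumes choice: countable_choice_for_finite_sets
  shows countable_unions_of_finite_sets_countable
  unfolding countable_unions_of_finite_sets_countable_def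
proof (intro allI impI)
  fix u assume "countable_union_of_finite_sets u"
  then obtain F where F: "countable_set F" "\<And>x. x \<in>\<^sub>M F \<Longrightarrow> finite_set x" and u: "u = un F"
    unfolding countable_union_of_finite_sets_def is_union_iff by auto
  obtain i where i: "tdf1 i" "inj_on i (ext F)" "\<And>x. x \<in>\<^sub>M F \<Longrightarrow> i x \<in>\<^sub>M om"
    using countableE[OF F(1)] by metis
  \<comment> \<open>The sets to which choice is applied. Empty members of \<open>F\<close> need no
    exception, since the empty function is a bijection.\<close>
  define B where "B x = Sep (Pw (prod x (card x))) (\<lambda>f. bijection f x (card x))" for x
  have tdfB: "tdf1 B" unfolding B_def by (intro dfn_intros)
  have B: "f \<in>\<^sub>M B x \<longleftrightarrow> bijection f x (card x)" for f x
  proof -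
    have "f \<in>\<^sub>M B x \<longleftrightarrow> f \<in>\<^sub>M Pw (prod x (card x)) \<and> bijection f x (card x)"
      unfolding B_def by (rule mem_Sep) (intro dfn_intros)
    then show ?thesis using injection_subset_prod unfolding bijection_def by auto
  qed
  have finB: "finite_set (B x)" if "x \<in>\<^sub>M F" for x
  proof (rule finite_subset)
    show "finite_set (Pw (prod x (card x)))"
      using F(2)[OF that] card(1) finite_om by (intro finite_Pw finite_prod) blast+
    show "subset (B x) (Pw (prod x (card x)))"
      using injection_subset_prod unfolding subset_def[of "B x"] B bijection_def by auto
  qed
  have neB: "nonempty (B x)" if "x \<in>\<^sub>M F" for x
    using card(2)[OF F(2)[OF that]] unfolding nonempty_def B eqp_def .
  have "\<forall>y. y \<in>\<^sub>M Repl F B \<longrightarrow> nonempty y \<and> finite_set y"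
    using finB neB unfolding mem_Repl[OF tdfB] by blast
  then obtain c where c: "choice_function c (Repl F B)"
    using choice countable_Repl[OF F(1) tdfB] unfolding countable_choice_for_finite_sets_def by blast
  have cB: "bijection (app c (B x)) x (card x)" if "x \<in>\<^sub>M F" for x
  proof -
    have "function_on c (Repl F B)" "\<And>x y. rel c x y \<Longrightarrow> y \<in>\<^sub>M x"
      using c unfolding choice_function_def by auto
    then have "app c (B x) \<in>\<^sub>M B x" using function_on_rel that by (auto simp: mem_Repl[OF tdfB])
    then show ?thesis by (simp add: B)
  qed
  \<comment> \<open>An element may lie in many members of \<open>F\<close>. \<open>X z\<close> is
    the member of least index that contains \<open>z\<close>, \<open>j z\<close> is this index, and
    \<open>k z\<close> is the position of \<open>z\<close> in the chosen enumeration of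
    \<open>X z\<close>.\<close>
  define J where "J z n \<longleftrightarrow> (\<exists>x. x \<in>\<^sub>M F \<and> i x = n \<and> z \<in>\<^sub>M x)" for z n
  define j where "j z = least (J z)" for z
  define X where "X z = desc (\<lambda>x. x \<in>\<^sub>M F \<and> i x = j z)" for z
  define k where "k z = app (app c (B (X z))) z" for z
  have J: "dfn1 (J z)" for z unfolding J_def by (intro dfn_intros tdf1_app[OF i(1)])
  have tdfj: "tdf1 j" unfolding j_def J_def by (intro dfn_intros tdf1_app[OF i(1)])
  have tdfk: "tdf1 k"
    unfolding k_def X_def by (intro dfn_intros tdf1_app[OF i(1)] tdf1_app[OF tdfj] tdf1_app[OF tdfB])
  have X: "X z \<in>\<^sub>M F" "i (X z) = j z" "z \<in>\<^sub>M X z" if z: "z \<in>\<^sub>M u" for z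
  proof -
    obtain y where y: "y \<in>\<^sub>M F" "z \<in>\<^sub>M y" using z by (auto simp: u)
    then have "J z (i y)" by (auto simp: J_def)
    then have "J z (j z)" unfolding j_def using least(2)[OF J] i(3) y by blast
    then obtain x where x: "x \<in>\<^sub>M F" "i x = j z" "z \<in>\<^sub>M x" by (auto simp: J_def)
    have "y = x" if "y \<in>\<^sub>M F \<and> i y = j z" for y using inj_onD[OF i(2), of y x] x that by simp
    then have "X z = x" unfolding X_def using x by (intro desc_eq) blast+
    then show "X z \<in>\<^sub>M F" "i (X z) = j z" "z \<in>\<^sub>M X z" using x by auto
  qed
  have j_om: "j z \<in>\<^sub>M om" if "z \<in>\<^sub>M u" for z using X[OF that] i(3) by metis
  have k_om: "k z \<in>\<^sub>M om" if z: "z \<in>\<^sub>M u" for z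
  proof -
    have "k z \<in>\<^sub>M card (X z)"
      using cB[OF X(1)[OF z]] X(3)[OF z] unfolding k_def bijection_def injection_iff by simp
    then show ?thesis using om_trans card(1) F(2) X(1)[OF z] by blast
  qed
  define lt where "lt z z' \<longleftrightarrow> j z \<in>\<^sub>M j z' \<or> (j z = j z' \<and> k z \<in>\<^sub>M k z')" for z z'
  show "countable_set u"
  proof (rule countable_order)
    show "dfn2 lt" unfolding lt_def by (intro dfn_intros tdf1_app[OF tdfj] tdf1_app[OF tdfk])
    show "\<not> lt z z" for z by (simp add: lt_def)
    show "lt x z" if "x \<in>\<^sub>M u" "y \<in>\<^sub>M u" "z \<in>\<^sub>M u" "lt x y" "lt y z" for x y z
      using that(4,5) om_mem_trans[OF j_om[OF that(3)], of "j y" "j x"]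
        om_mem_trans[OF k_om[OF that(3)], of "k y" "k x"]
      unfolding lt_def by auto
    show "lt x y \<or> lt y x" if "x \<in>\<^sub>M u" "y \<in>\<^sub>M u" "x \<noteq> y" for x y
    proof (cases "j x = j y")
      case True
      then have eq: "X x = X y" by (simp add: X_def)
      have "inj_on (app (app c (B (X x)))) (ext (X x))"
        using cB[OF X(1)[OF that(1)]] unfolding bijection_def injection_iff by blast
      then have "k x \<noteq> k y"
        using X(3)[OF that(1)] X(3)[OF that(2)] that(3) unfolding k_def eq
        by (auto dest: inj_onD)
      then show ?thesis using om_linear[OF k_om[OF that(1)] k_om[OF that(2)]] True
        unfolding lt_def by auto
    next
      case False
      then show ?thesis using om_linear[OF j_om[OF that(1)] j_om[OF that(2)]]
        unfolding lt_def by auto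
    qed
    show "finite_set (Sep u (\<lambda>z. lt z y))" if y: "y \<in>\<^sub>M u" for y
    proof -
      \<comment> \<open>Whatever precedes \<open>y\<close> has first index at most
        \<open>j y\<close>, hence lies in one of the members with such an index; the injective
        \<open>i\<close> leaves only finitely many of them.\<close>
      define I where "I = Sep F (\<lambda>x. i x \<in>\<^sub>M ins (j y) (j y))"
      have I: "x \<in>\<^sub>M I \<longleftrightarrow> x \<in>\<^sub>M F \<and> i x \<in>\<^sub>M ins (j y) (j y)" for x
        unfolding I_def by (rule mem_Sep) (intro dfn_intros tdf1_app[OF i(1)])
      have id: "tdf1 (\<lambda>x. x)" by (intro dfn_intros)
      have "inj_on i (ext I)" by (rule inj_on_subset[OF i(2)]) (auto simp: I)
      then have "finite_set I"
        by (rule finite_inj[OF i(1)]) (use I in blast, use finite_om om_succ j_om[OF y] in blast)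
      then have fin: "finite_set (un (Repl I (\<lambda>x. x)))"
        by (rule finite_UN[OF _ id]) (use F(2) I in blast)
      show ?thesis
      proof (rule finite_subset[OF fin], unfold subset_def, intro allI impI)
        fix z assume "z \<in>\<^sub>M Sep u (\<lambda>z. lt z y)"
        moreover have "dfn1 (\<lambda>z. lt z y)"
          unfolding lt_def by (intro dfn_intros tdf1_app[OF tdfj] tdf1_app[OF tdfk])
        ultimately have z: "z \<in>\<^sub>M u" "lt z y" by (auto simp: mem_Sep)
        then have "X z \<in>\<^sub>M I" using X[of z] unfolding I lt_def by auto
        then show "z \<in>\<^sub>M un (Repl I (\<lambda>x. x))"
          using X(3)[OF z(1)] by (auto simp: mem_Repl[OF id])
      qed
    qed
  qed
qed

subsection \<open>Countable unions imply generic filters\<close>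

text \<open>
  The graph of \<open>a\<close> is the least subset of \<open>\<omega> \<times> P\<close> that contains \<open>(0, p)\<close> and is closed under
  \<open>(n, q) \<mapsto> (n + 1, S n q)\<close>.
\<close>

lemma om_recursion:
  assumes S: "tdf2 S" and p: "p \<in>\<^sub>M P" and SP: "\<And>n q. n \<in>\<^sub>M om \<Longrightarrow> q \<in>\<^sub>M P \<Longrightarrow> S n q \<in>\<^sub>M P"
  obtains a where "tdf1 a" "a emp = p" "\<And>n. n \<in>\<^sub>M om \<Longrightarrow> a n \<in>\<^sub>M P"
    "\<And>n. n \<in>\<^sub>M om \<Longrightarrow> a (ins n n) = S n (a n)"
proof -
  define closed where "closed X \<longleftrightarrow> opair emp p \<in>\<^sub>M X \<and>
    (\<forall>n q. n \<in>\<^sub>M om \<and> q \<in>\<^sub>M P \<and> opair n q \<in>\<^sub>M X \<longrightarrow> opair (ins n n) (S n q) \<in>\<^sub>M X)" for X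
  have dfn_closed: "dfn1 closed" unfolding closed_def by (intro dfn_intros tdf2_app[OF S])
  define H where "H = Sep (prod om P) (\<lambda>z. \<forall>X. closed X \<longrightarrow> z \<in>\<^sub>M X)"
  have H: "z \<in>\<^sub>M H \<longleftrightarrow> z \<in>\<^sub>M prod om P \<and> (\<forall>X. closed X \<longrightarrow> z \<in>\<^sub>M X)" for z
    unfolding H_def by (rule mem_Sep) (intro dfn_intros dfn1_app[OF dfn_closed])
  have closed_H: "closed H" unfolding closed_def[of H] H using p SP by (auto simp: closed_def)
  \<comment> \<open>A pair that is neither the initial one nor produced from a pair in
    \<open>H\<close> can be deleted without losing closure. As \<open>H\<close> is least, it
    contains no such pair; this makes the value at each \<open>n\<close> unique.\<close>
  have removable: "closed (Sep H (\<lambda>z. z \<noteq> w))" if "w \<noteq> opair emp p"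
    "\<And>n q. n \<in>\<^sub>M om \<Longrightarrow> q \<in>\<^sub>M P \<Longrightarrow> opair n q \<in>\<^sub>M H \<Longrightarrow> w \<noteq> opair (ins n n) (S n q)" for w
  proof -
    have "z \<in>\<^sub>M Sep H (\<lambda>z. z \<noteq> w) \<longleftrightarrow> z \<in>\<^sub>M H \<and> z \<noteq> w" for z
      by (rule mem_Sep) (intro dfn_intros)
    then show ?thesis using closed_H that unfolding closed_def by metis
  qed
  have minimal: "w = opair emp p \<or> (\<exists>n q. n \<in>\<^sub>M om \<and> q \<in>\<^sub>M P \<and> opair n q \<in>\<^sub>M H \<and> w = opair (ins n n) (S n q))"
    if w: "w \<in>\<^sub>M H" for w
  proof (rule ccontr)
    assume no: "\<not> ?thesis"
    have "closed (Sep H (\<lambda>z. z \<noteq> w))" by (rule removable) (use no in blast)+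
    then have "w \<in>\<^sub>M Sep H (\<lambda>z. z \<noteq> w)" using w H by blast
    moreover have "z \<in>\<^sub>M Sep H (\<lambda>z. z \<noteq> w) \<longleftrightarrow> z \<in>\<^sub>M H \<and> z \<noteq> w" for z
      by (rule mem_Sep) (intro dfn_intros)
    ultimately show False by blast
  qed
  have ne: "ins n n \<noteq> emp" for n by (metis mem_emp mem_ins)
  have unique: "\<exists>!q. opair n q \<in>\<^sub>M H" if n: "n \<in>\<^sub>M om" for n
  proof -
    have "dfn1 (\<lambda>n. \<exists>!q. opair n q \<in>\<^sub>M H)" by (intro dfn_intros)
    with n show ?thesis
    proof (induct rule: om_induct)
      case zero
      have "opair emp p \<in>\<^sub>M H" using closed_H by (simp add: closed_def)
      moreover have "q = p" if "opair emp q \<in>\<^sub>M H" for q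
        using minimal[OF that] ne by (metis opair_inject)
      ultimately show ?case by blast
    next
      case (succ n)
      then obtain q where q: "opair n q \<in>\<^sub>M H" "\<And>q'. opair n q' \<in>\<^sub>M H \<Longrightarrow> q' = q" by blast
      have "q \<in>\<^sub>M P" using q(1) by (simp add: H)
      then have "opair (ins n n) (S n q) \<in>\<^sub>M H" using closed_H q(1) succ(1) unfolding closed_def by blast
      moreover have "s = S n q" if "opair (ins n n) s \<in>\<^sub>M H" for s
        using minimal[OF that] ne q(2) by auto
      ultimately show ?case by blast
    qed
  qed
  define a where "a n = desc (\<lambda>q. opair n q \<in>\<^sub>M H)" for n
  have a: "opair n (a n) \<in>\<^sub>M H" if "n \<in>\<^sub>M om" for n
    unfolding a_def by (rule desc_sat[OF unique[OF that]])
  have a_eq: "a n = q" if "n \<in>\<^sub>M om" "opair n q \<in>\<^sub>M H" for n q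
    using a[OF that(1)] unique[OF that(1)] that(2) by blast
  have aP: "a n \<in>\<^sub>M P" if "n \<in>\<^sub>M om" for n using a[OF that] by (simp add: H)
  show ?thesis
  proof
    show "tdf1 a" unfolding a_def by (intro dfn_intros)
    show "a emp = p" using a_eq[of emp p] closed_H by (simp add: closed_def)
    show "a n \<in>\<^sub>M P" if "n \<in>\<^sub>M om" for n using aP that .
    show "a (ins n n) = S n (a n)" if "n \<in>\<^sub>M om" for n
      using a_eq[of "ins n n" "S n (a n)"] closed_H a[OF that] aP[OF that] that
      unfolding closed_def by simp
  qed
qed

lemma partial_orderD:
  assumes "partial_order P r"
  shows "rel r x y \<Longrightarrow> x \<in>\<^sub>M P" "rel r x y \<Longrightarrow> y \<in>\<^sub>M P" "x \<in>\<^sub>M P \<Longrightarrow> rel r x x"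
    "rel r x y \<Longrightarrow> rel r y x \<Longrightarrow> x = y" "rel r x y \<Longrightarrow> rel r y z \<Longrightarrow> rel r x z"
proof -
  show "x \<in>\<^sub>M P" "y \<in>\<^sub>M P" if xy: "rel r x y"
  proof -
    have "\<exists>x' y'. opair x y = opair x' y' \<and> x' \<in>\<^sub>M P \<and> y' \<in>\<^sub>M P"
      using assms xy unfolding partial_order_def rel_iff is_opair_iff' by blast
    then show "x \<in>\<^sub>M P" "y \<in>\<^sub>M P" by auto
  qed
qed (use assms in \<open>unfold partial_order_def, blast+\<close>)

lemma unions_countable_imp_generic:
  assumes unions: countable_unions_of_finite_sets_countable
  shows generic_filters_exist
  unfolding generic_filters_exist_def
proof (intro allI impI, elim conjE)
  fix P r \<D>
  assume po: "partial_order P r" and "nonempty P" and "countable_union_of_finite_sets P"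
    and \<D>: "countable_set \<D>" "\<forall>D. D \<in>\<^sub>M \<D> \<longrightarrow> dense_in P r D"
  note po = partial_orderD[OF po]
  obtain p where p: "p \<in>\<^sub>M P" using \<open>nonempty P\<close> unfolding nonempty_def by blast
  have "countable_set P"
    using unions \<open>countable_union_of_finite_sets P\<close>
    unfolding countable_unions_of_finite_sets_countable_def by blast
  then obtain f where f: "tdf1 f" "inj_on f (ext P)" "\<And>x. x \<in>\<^sub>M P \<Longrightarrow> f x \<in>\<^sub>M om" using countableE by blast
  obtain d where d: "tdf1 d" "inj_on d (ext \<D>)" "\<And>x. x \<in>\<^sub>M \<D> \<Longrightarrow> d x \<in>\<^sub>M om" using countableE[OF \<D>(1)] by metis
  \<comment> \<open>Request number \<open>n\<close> is to enter the dense set with code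
    \<open>n\<close>. By injectivity of \<open>d\<close> there is at most one; for a number that is
    no code the request is void and \<open>p\<close> itself is good.\<close>
  define good where "good n p q \<longleftrightarrow> q \<in>\<^sub>M P \<and> rel r q p \<and> (\<forall>D. D \<in>\<^sub>M \<D> \<and> d D = n \<longrightarrow> q \<in>\<^sub>M D)" for n p q
  \<comment> \<open>Density gives good conditions but selects none. The countability of
    \<open>P\<close> does: the one of least code is definable.\<close>
  define M where "M n p = least (\<lambda>m. \<exists>q. good n p q \<and> f q = m)" for n p
  define S where "S n p = desc (\<lambda>q. good n p q \<and> f q = M n p)" for n p
  have tdf_S: "tdf2 S"
    unfolding S_def M_def good_def by (intro dfn_intros tdf1_app[OF f(1)] tdf1_app[OF d(1)])
  have good_ex: "\<exists>q. good n p q" if pP: "p \<in>\<^sub>M P" for n p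
  proof (cases "\<exists>D. D \<in>\<^sub>M \<D> \<and> d D = n")
    case True
    then obtain D where D: "D \<in>\<^sub>M \<D>" "d D = n" by blast
    then have unique: "D' = D" if "D' \<in>\<^sub>M \<D>" "d D' = n" for D' using inj_onD[OF d(2), of D' D] that by simp
    obtain q where "q \<in>\<^sub>M D" "rel r q p" using \<D>(2) D(1) pP unfolding dense_in_def by blast
    then have "good n p q" using unique po(1) unfolding good_def by blast
    then show ?thesis ..
  next
    case False
    then have "good n p p" using po(3) that unfolding good_def by blast
    then show ?thesis ..
  qed
  have S: "good n p (S n p)" if pP: "p \<in>\<^sub>M P" for n p
  proof -
    obtain q where q: "good n p q" using good_ex[OF pP] by blast
    have dfn: "dfn1 (\<lambda>m. \<exists>q. good n p q \<and> f q = m)"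
      unfolding good_def by (intro dfn_intros tdf1_app[OF f(1)] tdf1_app[OF d(1)])
    have "f q \<in>\<^sub>M om" using f(3) q by (simp add: good_def)
    from least(2)[OF dfn this] q have "\<exists>q. good n p q \<and> f q = M n p" unfolding M_def by blast
    then obtain q' where q': "good n p q'" "f q' = M n p" by blast
    have "S n p = q'" unfolding S_def
    proof (rule desc_eq)
      show "z = q'" if "good n p z \<and> f z = M n p" for z
        using inj_onD[OF f(2), of z q'] that q' unfolding good_def by simp
    qed (use q' in blast)
    then show ?thesis using q' by simp
  qed
  then have SP: "S n q \<in>\<^sub>M P" if "q \<in>\<^sub>M P" for n q using that unfolding good_def by blast
  obtain a where a: "tdf1 a" "\<And>n. n \<in>\<^sub>M om \<Longrightarrow> a n \<in>\<^sub>M P" "\<And>n. n \<in>\<^sub>M om \<Longrightarrow> a (ins n n) = S n (a n)"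
    using om_recursion[OF tdf_S p SP] by blast
  have good: "good n (a n) (a (ins n n))" if "n \<in>\<^sub>M om" for n using S a that by simp
  have dec: "rel r (a n) (a m)" if n: "n \<in>\<^sub>M om" and m: "m \<in>\<^sub>M n \<or> m = n" for n m
  proof -
    have "dfn1 (\<lambda>n. \<forall>m. m \<in>\<^sub>M n \<or> m = n \<longrightarrow> rel r (a n) (a m))" by (intro dfn_intros tdf1_app[OF a(1)])
    with n have "\<forall>m. m \<in>\<^sub>M n \<or> m = n \<longrightarrow> rel r (a n) (a m)"
    proof (induct rule: om_induct)
      case zero then show ?case using po(3) a(2) by simp
    next
      case (succ n)
      have "rel r (a (ins n n)) (a n)" using good[OF succ(1)] by (simp add: good_def)
      moreover have "rel r (a (ins n n)) (a (ins n n))" using po(3) a(2) succ(1) by simp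
      ultimately show ?case using succ(2) po(5) by (metis mem_ins)
    qed
    then show ?thesis using m by blast
  qed
  define G where "G = Sep P (\<lambda>q. \<exists>n. n \<in>\<^sub>M om \<and> rel r (a n) q)"
  have G: "q \<in>\<^sub>M G \<longleftrightarrow> (\<exists>n. n \<in>\<^sub>M om \<and> rel r (a n) q)" for q
  proof -
    have "q \<in>\<^sub>M G \<longleftrightarrow> q \<in>\<^sub>M P \<and> (\<exists>n. n \<in>\<^sub>M om \<and> rel r (a n) q)"
      unfolding G_def by (rule mem_Sep) (intro dfn_intros tdf1_app[OF a(1)])
    then show ?thesis using po(2) by blast
  qed
  have aG: "a n \<in>\<^sub>M G" if "n \<in>\<^sub>M om" for n using G a(2) po(3) that by blast
  have "generic_filter P r \<D> G"
    unfolding generic_filter_def filter_in_def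
  proof (intro conjI allI impI)
    show "subset G P" using po(2) by (auto simp: subset_def G)
    show "q \<in>\<^sub>M G" if "p \<in>\<^sub>M G \<and> rel r p q" for p q using that po(5) G by blast
    show "\<exists>s. s \<in>\<^sub>M G \<and> rel r s p \<and> rel r s q" if pq: "p \<in>\<^sub>M G \<and> q \<in>\<^sub>M G" for p q
    proof -
      obtain n m where nm: "n \<in>\<^sub>M om" "rel r (a n) p" "m \<in>\<^sub>M om" "rel r (a m) q" using pq G by blast
      show ?thesis
      proof (cases "m \<in>\<^sub>M n \<or> m = n")
        case True
        then show ?thesis using dec[OF nm(1)] po(5) nm aG by blast
      next
        case False
        then have "n \<in>\<^sub>M m" using om_linear nm by blast
        then show ?thesis using dec[OF nm(3)] po(5) nm aG by blast
      qed
    qed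
    show "\<exists>x. x \<in>\<^sub>M G \<and> x \<in>\<^sub>M D" if D: "D \<in>\<^sub>M \<D>" for D
    proof (intro exI conjI)
      \<comment> \<open>Request \<open>d D\<close> is met in passing from stage \<open>d D\<close>
        to its successor.\<close>
      show "a (ins (d D) (d D)) \<in>\<^sub>M D" using good[OF d(3)[OF D]] D by (simp add: good_def)
      show "a (ins (d D) (d D)) \<in>\<^sub>M G" by (intro aG om_succ d(3) D)
    qed
  qed
  then show "\<exists>G. generic_filter P r \<D> G" ..
qed

subsection \<open>Generic filters imply Koenig's Lemma\<close>

lemma strictD:
  assumes "partial_order T r"
  shows "strict r x y \<Longrightarrow> strict r y z \<Longrightarrow> strict r x z"
    "strict r x y \<Longrightarrow> rel r y z \<Longrightarrow> strict r x z" "rel r x y \<Longrightarrow> strict r y z \<Longrightarrow> strict r x z"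
    "\<not> strict r x x" "strict r x y \<Longrightarrow> rel r x y"
  using partial_orderD(4,5)[OF assms] unfolding strict_def by blast+

text \<open>The tree condition covers only strict predecessors of \<open>t\<close>, so the case that
  \<open>x\<close> or \<open>y\<close> is \<open>t\<close> itself is split off.\<close>

lemma tree_linear:
  assumes tree: "tree T r" and x: "rel r x t" and y: "rel r y t"
  shows "rel r x y \<or> rel r y x"
proof (cases "x = t \<or> y = t")
  case False
  have t: "t \<in>\<^sub>M T" using tree x partial_orderD(2) unfolding tree_def by blast
  have "\<forall>s. s \<in>\<^sub>M upair x y \<longrightarrow> strict r s t" using False x y by (auto simp: strict_def)
  moreover have "nonempty (upair x y)" by (auto simp: nonempty_def)
  ultimately have "\<exists>m. m \<in>\<^sub>M upair x y \<and> (\<forall>s. s \<in>\<^sub>M upair x y \<longrightarrow> rel r m s)"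
    using tree t unfolding tree_def by blast
  then show ?thesis by auto
qed (use x y in auto)

lemma generic_imp_Koenig:
  assumes generic: generic_filters_exist
  shows Koenigs_lemma
  unfolding Koenigs_lemma_def
proof (intro allI impI, elim conjE)
  fix T r
  assume tree: "tree T r" and rooted: "rooted T r" and height: "height_omega T r"
    and branching: "finitely_branching T r" and inf: "\<not> finite_set T"
  have partial: "partial_order T r" using tree by (simp add: tree_def)
  note po = partial_orderD[OF partial] and str = strictD[OF partial]
  note linear = tree_linear[OF tree]

  \<comment> \<open>Predecessors, heights, successors and cones\<close>
  define pred where "pred t = Sep T (\<lambda>s. strict r s t)" for t
  have pred: "s \<in>\<^sub>M pred t \<longleftrightarrow> strict r s t" for s t
  proof -
    have "s \<in>\<^sub>M pred t \<longleftrightarrow> s \<in>\<^sub>M T \<and> strict r s t" unfolding pred_def by (rule mem_Sep) (intro dfn_intros)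
    then show ?thesis using po(1) by (auto simp: strict_def)
  qed
  have tdf_pred: "tdf1 pred" unfolding pred_def by (intro dfn_intros)
  have fin_pred: "finite_set (pred t)" if t: "t \<in>\<^sub>M T" for t
  proof -
    obtain n where n: "n \<in>\<^sub>M om" "node_height r t n"
      using height t unfolding height_omega_def is_omega_iff by blast
    then obtain p f where p: "\<forall>s. s \<in>\<^sub>M p \<longleftrightarrow> strict r s t" and f: "bijection f p n"
      unfolding node_height_def by blast
    have "p = pred t" by (rule set_ext) (simp add: p pred)
    then show ?thesis using n f unfolding finite_iff eqp_def by blast
  qed
  define ht where "ht t = card (pred t)" for t
  have tdf_ht: "tdf1 ht" unfolding ht_def by (intro dfn_intros tdf_pred)
  have ht_om: "ht t \<in>\<^sub>M om" if "t \<in>\<^sub>M T" for t using card(1) fin_pred that unfolding ht_def by blast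
  define succs where "succs t = Sep T (\<lambda>s. immediate_succ r t s)" for t
  have succs: "s \<in>\<^sub>M succs t \<longleftrightarrow> immediate_succ r t s" for s t
  proof -
    have "s \<in>\<^sub>M succs t \<longleftrightarrow> s \<in>\<^sub>M T \<and> immediate_succ r t s"
      unfolding succs_def by (rule mem_Sep) (intro dfn_intros)
    then show ?thesis using po(2) by (auto simp: immediate_succ_def strict_def)
  qed
  have tdf_succs: "tdf1 succs" unfolding succs_def by (intro dfn_intros)
  have fin_succs: "finite_set (succs t)" if t: "t \<in>\<^sub>M T" for t
  proof -
    obtain S where S: "\<forall>s. s \<in>\<^sub>M S \<longleftrightarrow> immediate_succ r t s" "finite_set S"
      using branching t unfolding finitely_branching_def by blast
    have "S = succs t" by (rule set_ext) (simp add: S succs)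
    then show ?thesis using S by simp
  qed
  define up where "up t = Sep T (\<lambda>s. rel r t s)" for t
  have up: "s \<in>\<^sub>M up t \<longleftrightarrow> rel r t s" for s t
  proof -
    have "s \<in>\<^sub>M up t \<longleftrightarrow> s \<in>\<^sub>M T \<and> rel r t s" unfolding up_def by (rule mem_Sep) (intro dfn_intros)
    then show ?thesis using po(2) by auto
  qed
  have tdf_up: "tdf1 up" unfolding up_def by (intro dfn_intros)

  \<comment> \<open>Immediate successors\<close>
  have pred_succ: "pred u = ins t (pred t)" if tu: "immediate_succ r t u" for t u
  proof (rule set_ext)
    fix v
    have t_u: "strict r t u" using tu by (simp add: immediate_succ_def)
    show "v \<in>\<^sub>M pred u \<longleftrightarrow> v \<in>\<^sub>M ins t (pred t)"
    proof
      assume "v \<in>\<^sub>M pred u"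
      then have vu: "strict r v u" by (simp add: pred)
      then have "rel r v t \<or> rel r t v" using linear t_u str(5) by blast
      moreover have "\<not> strict r t v" using tu vu unfolding immediate_succ_def by blast
      ultimately show "v \<in>\<^sub>M ins t (pred t)" by (auto simp: pred strict_def)
    next
      assume "v \<in>\<^sub>M ins t (pred t)"
      then show "v \<in>\<^sub>M pred u" using t_u str(1) by (auto simp: pred)
    qed
  qed
  have ht_succ: "ht u = ins (ht t) (ht t)" if tu: "immediate_succ r t u" for t u
  proof -
    have "t \<in>\<^sub>M T" using tu po(1) unfolding immediate_succ_def strict_def by blast
    then show ?thesis
      unfolding ht_def pred_succ[OF tu] using card_ins fin_pred str(4) pred by blast
  qed
  have below_succ: "\<exists>u. immediate_succ r t u \<and> rel r u s" if ts: "strict r t s" for t s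
  proof -
    \<comment> \<open>The nodes strictly between \<open>t\<close> and \<open>s\<close> are
      predecessors of \<open>s\<close>. The least of them is an immediate successor of
      \<open>t\<close>; if there are none, \<open>s\<close> is one.\<close>
    define A where "A = Sep T (\<lambda>u. strict r t u \<and> strict r u s)"
    have "u \<in>\<^sub>M A \<longleftrightarrow> u \<in>\<^sub>M T \<and> strict r t u \<and> strict r u s" for u
      unfolding A_def by (rule mem_Sep) (intro dfn_intros)
    then have A: "u \<in>\<^sub>M A \<longleftrightarrow> strict r t u \<and> strict r u s" for u
      using po(1) unfolding strict_def by blast
    have s: "s \<in>\<^sub>M T" "rel r s s" using ts po(2,3) unfolding strict_def by blast+
    show ?thesis
    proof (cases "nonempty A")
      case True
      then obtain m where m: "m \<in>\<^sub>M A" "\<forall>u. u \<in>\<^sub>M A \<longrightarrow> rel r m u"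
        using tree s A unfolding tree_def by blast
      have "\<not> (strict r t v \<and> strict r v m)" for v
      proof
        assume v: "strict r t v \<and> strict r v m"
        then have "v \<in>\<^sub>M A" using m(1) str(1) unfolding A by blast
        then show False using m(2) v str(2,4) by blast
      qed
      then have "immediate_succ r t m" using m(1) unfolding A immediate_succ_def by blast
      then show ?thesis using m(1) str(5) unfolding A by blast
    next
      case False
      then have "immediate_succ r t s" using ts unfolding immediate_succ_def nonempty_def A by blast
      then show ?thesis using s by blast
    qed
  qed
  have pred_max: "\<exists>m. immediate_succ r m s" if s: "s \<in>\<^sub>M T" and ne: "nonempty (pred s)" for s
  proof -
    \<comment> \<open>Well-ordering yields least elements only. A greatest predecessor exists
      because the predecessors form a finite chain, by induction on its subsets.\<close>
    have "dfn1 (\<lambda>x. subset x (pred s) \<and> nonempty x \<longrightarrow> (\<exists>m. m \<in>\<^sub>M x \<and> (\<forall>y. y \<in>\<^sub>M x \<longrightarrow> rel r y m)))"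
      by (intro dfn_intros)
    with fin_pred[OF s] have "subset (pred s) (pred s) \<and> nonempty (pred s) \<longrightarrow>
      (\<exists>m. m \<in>\<^sub>M pred s \<and> (\<forall>y. y \<in>\<^sub>M pred s \<longrightarrow> rel r y m))"
    proof (induct rule: finite_induct)
      case empty then show ?case by (simp add: nonempty_def)
    next
      case (ins a x)
      show ?case
      proof
        assume *: "subset (local.ins a x) (pred s) \<and> nonempty (local.ins a x)"
        then have a: "strict r a s" and x: "\<And>y. y \<in>\<^sub>M x \<Longrightarrow> strict r y s"
          by (auto simp: subset_def pred)
        then have aa: "rel r a a" using po(1,3) str(5) by blast
        show "\<exists>m. m \<in>\<^sub>M local.ins a x \<and> (\<forall>y. y \<in>\<^sub>M local.ins a x \<longrightarrow> rel r y m)"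
        proof (cases "nonempty x")
          case True
          then obtain m where m: "m \<in>\<^sub>M x" "\<And>y. y \<in>\<^sub>M x \<Longrightarrow> rel r y m"
            using ins(3) x by (auto simp: subset_def pred)
          show ?thesis
          proof (cases "rel r a m")
            case True
            then show ?thesis using m by auto
          next
            case False
            then have "rel r m a" using linear str(5) a x m(1) by blast
            then have "\<forall>y. y \<in>\<^sub>M local.ins a x \<longrightarrow> rel r y a" using m(2) aa po(5) unfolding mem_ins by blast
            then show ?thesis by auto
          qed
        next
          case False
          then show ?thesis using aa by (auto simp: nonempty_def)
        qed
      qed
    qed
    then obtain m where m: "strict r m s" "\<And>y. strict r y s \<Longrightarrow> rel r y m"
      using ne by (auto simp: subset_def pred)
    have "\<not> (strict r m u \<and> strict r u s)" for u using m(2) str(2,4) by blast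
    then show ?thesis using m(1) unfolding immediate_succ_def by blast
  qed

  \<comment> \<open>Finiteness of the levels\<close>
  obtain t0 where t0: "t0 \<in>\<^sub>M T" "\<And>t. t \<in>\<^sub>M T \<Longrightarrow> rel r t0 t" using rooted unfolding rooted_def by blast
  define level where "level n = Sep T (\<lambda>t. ht t = n)" for n
  have level: "t \<in>\<^sub>M level n \<longleftrightarrow> t \<in>\<^sub>M T \<and> ht t = n" for t n
    unfolding level_def by (rule mem_Sep) (intro dfn_intros tdf1_app[OF tdf_ht])
  have tdf_level: "tdf1 level" unfolding level_def by (intro dfn_intros tdf1_app[OF tdf_ht])
  \<comment> \<open>Only the root has height zero, and level \<open>n + 1\<close> is covered by the
    successor sets of the nodes of level \<open>n\<close>. A finite union of finite sets is finite
    without any choice.\<close>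
  have fin_level: "finite_set (level n)" if n: "n \<in>\<^sub>M om" for n
  proof -
    have "dfn1 (\<lambda>n. finite_set (level n))" by (intro dfn_intros tdf1_app[OF tdf_level])
    with n show ?thesis
    proof (induct rule: om_induct)
      case zero
      have "t = t0" if "t \<in>\<^sub>M level emp" for t
      proof (rule ccontr)
        assume "t \<noteq> t0"
        have t: "t \<in>\<^sub>M T" "ht t = emp" using that by (auto simp: level)
        then have "t0 \<in>\<^sub>M pred t" using t0(2) \<open>t \<noteq> t0\<close> by (auto simp: pred strict_def)
        moreover have "pred t = emp" using card_eq_empD[OF fin_pred[OF t(1)]] t(2) by (simp add: ht_def)
        ultimately show False by simp
      qed
      then have "subset (level emp) (ins t0 emp)" by (auto simp: subset_def)
      then show ?case using finite_subset finite_ins[OF finite_emp] by blast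
    next
      case (succ n)
      have fin: "finite_set (un (Repl (level n) succs))"
        by (rule finite_UN[OF succ(2) tdf_succs]) (use fin_succs level in blast)
      have "s \<in>\<^sub>M un (Repl (level n) succs)" if "s \<in>\<^sub>M level (ins n n)" for s
      proof -
        have s: "s \<in>\<^sub>M T" "ht s = ins n n" using that by (auto simp: level)
        have "pred s \<noteq> emp"
        proof
          assume "pred s = emp"
          then have "card emp = ins n n" using s(2) by (simp add: ht_def)
          moreover have "card emp = emp" by (rule card_eqI[OF om_emp eqp_refl])
          ultimately have "n \<in>\<^sub>M emp" by (metis mem_ins)
          then show False by simp
        qed
        then obtain m where m: "immediate_succ r m s" using pred_max[OF s(1)] nonempty_iff by blast
        then have "ht m = n" using ht_succ s(2) by simp
        moreover have "m \<in>\<^sub>M T" using m po(1) unfolding immediate_succ_def strict_def by blast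
        ultimately show ?thesis using m by (auto simp: mem_Repl[OF tdf_succs] level succs)
      qed
      then show ?case by (intro finite_subset[OF fin]) (simp add: subset_def)
    qed
  qed

  \<comment> \<open>The partial order of nodes with infinite cones\<close>
  define P where "P = Sep T (\<lambda>t. \<not> finite_set (up t))"
  have P: "t \<in>\<^sub>M P \<longleftrightarrow> t \<in>\<^sub>M T \<and> \<not> finite_set (up t)" for t
    unfolding P_def by (rule mem_Sep) (intro dfn_intros tdf1_app[OF tdf_up])
  \<comment> \<open>If all immediate successors had finite cones, the cone of \<open>t\<close> would
    be \<open>t\<close> together with finitely many finite cones. This is why nodes with finite
    cones are discarded: without them every node can be extended, and the sets \<open>D n\<close>
    below are dense.\<close>
  have extend: "\<exists>u. u \<in>\<^sub>M P \<and> immediate_succ r t u" if t: "t \<in>\<^sub>M P" for t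
  proof (rule ccontr)
    assume no: "\<not> ?thesis"
    have fin: "finite_set (up u)" if "u \<in>\<^sub>M succs t" for u
      using no that po(2) unfolding P succs immediate_succ_def strict_def by blast
    have "finite_set (un (Repl (succs t) up))"
      by (rule finite_UN[OF _ tdf_up fin]) (use fin_succs t P in blast)+
    then have fin: "finite_set (ins t (un (Repl (succs t) up)))" by (rule finite_ins)
    have "subset (up t) (ins t (un (Repl (succs t) up)))"
      unfolding subset_def
    proof (intro allI impI)
      fix s assume "s \<in>\<^sub>M up t"
      then have ts: "rel r t s" by (simp add: up)
      show "s \<in>\<^sub>M ins t (un (Repl (succs t) up))"
      proof (cases "s = t")
        case False
        then obtain u where "immediate_succ r t u" "rel r u s" using below_succ[of t s] ts by (auto simp: strict_def)
        then show ?thesis by (auto simp: mem_Repl[OF tdf_up] succs up)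
      qed simp
    qed
    then show False using finite_subset[OF fin] t P by blast
  qed
  define q where "q = Sep (prod P P) (\<lambda>z. \<exists>x y. z = opair x y \<and> rel r y x)"
  have mem_q: "z \<in>\<^sub>M q \<longleftrightarrow> z \<in>\<^sub>M prod P P \<and> (\<exists>x y. z = opair x y \<and> rel r y x)" for z
    unfolding q_def by (rule mem_Sep) (intro dfn_intros)
  have q: "rel q x y \<longleftrightarrow> x \<in>\<^sub>M P \<and> y \<in>\<^sub>M P \<and> rel r y x" for x y
    unfolding rel_iff[of q] mem_q by auto
  have po_q: "partial_order P q"
    unfolding partial_order_def is_opair_iff'
  proof (intro conjI allI impI)
    show "\<exists>x y. p = opair x y \<and> x \<in>\<^sub>M P \<and> y \<in>\<^sub>M P" if "p \<in>\<^sub>M q" for p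
      using that mem_prod unfolding mem_q by blast
    show "rel q x x" if "x \<in>\<^sub>M P" for x using that po(3) P unfolding q by blast
    show "x = y" if "rel q x y \<and> rel q y x" for x y using that po(4) unfolding q by blast
    show "rel q x z" if "rel q x y \<and> rel q y z" for x y z using that po(5) unfolding q by blast
  qed
  have "up t0 = T" using t0(2) po(2) by (intro set_ext) (auto simp: up)
  then have t0P: "t0 \<in>\<^sub>M P" using t0(1) inf by (simp add: P)
  have cuf: "countable_union_of_finite_sets P"
  proof -
    define L where "L n = Sep (level n) (\<lambda>t. t \<in>\<^sub>M P)" for n
    have L: "t \<in>\<^sub>M L n \<longleftrightarrow> t \<in>\<^sub>M level n \<and> t \<in>\<^sub>M P" for t n
      unfolding L_def by (rule mem_Sep) (intro dfn_intros)
    have tdf_L: "tdf1 L" unfolding L_def by (intro dfn_intros tdf_level)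
    have "P = un (Repl om L)"
      by (rule set_ext, unfold mem_un mem_Repl[OF tdf_L]) (use ht_om P L level in metis)
    moreover have "finite_set (L n)" if "n \<in>\<^sub>M om" for n
      by (rule finite_subset[OF fin_level[OF that]]) (simp add: subset_def L)
    then have "\<forall>x. x \<in>\<^sub>M Repl om L \<longrightarrow> finite_set x" by (auto simp: mem_Repl[OF tdf_L])
    ultimately show ?thesis
      unfolding countable_union_of_finite_sets_def is_union_iff
      using countable_Repl[OF countable_om tdf_L] by blast
  qed
  \<comment> \<open>Between elements of \<open>om\<close>, \<open>subset\<close> is the order \<le>.
    Density follows by induction on \<open>n\<close>, with one application of \<open>extend\<close>
    for each unit of height.\<close>
  define D where "D n = Sep P (\<lambda>t. subset n (ht t))" for n
  have D: "t \<in>\<^sub>M D n \<longleftrightarrow> t \<in>\<^sub>M P \<and> subset n (ht t)" for t n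
    unfolding D_def by (rule mem_Sep) (intro dfn_intros tdf1_app[OF tdf_ht])
  have tdf_D: "tdf1 D" unfolding D_def by (intro dfn_intros tdf1_app[OF tdf_ht])
  have dense: "dense_in P q (D n)" if n: "n \<in>\<^sub>M om" for n
  proof -
    have "dfn1 (\<lambda>n. \<forall>p. p \<in>\<^sub>M P \<longrightarrow> (\<exists>t. t \<in>\<^sub>M D n \<and> rel q t p))"
      by (intro dfn_intros tdf1_app[OF tdf_D])
    with n have "\<forall>p. p \<in>\<^sub>M P \<longrightarrow> (\<exists>t. t \<in>\<^sub>M D n \<and> rel q t p)"
    proof (induct rule: om_induct)
      case zero
      have "p \<in>\<^sub>M D emp \<and> rel q p p" if "p \<in>\<^sub>M P" for p
        using that po(3) P by (auto simp: D q subset_def)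
      then show ?case by blast
    next
      case (succ n)
      show ?case
      proof (intro allI impI)
        fix p assume "p \<in>\<^sub>M P"
        then obtain t where t: "t \<in>\<^sub>M D n" "rel q t p" using succ(2) by blast
        then obtain u where u: "u \<in>\<^sub>M P" "immediate_succ r t u" using extend D by blast
        have "t \<in>\<^sub>M T" using t(1) by (simp add: D P)
        have "subset n (ht t)" using t(1) by (simp add: D)
        then have "subset (ins n n) (ht u)"
          using om_subset_iff[OF ht_om[OF \<open>t \<in>\<^sub>M T\<close>] succ(1)] ht_succ[OF u(2)] by (auto simp: subset_def)
        moreover have "rel r p u" using t(2) u(2) po(5) unfolding q immediate_succ_def strict_def by blast
        ultimately show "\<exists>t. t \<in>\<^sub>M D (ins n n) \<and> rel q t p"
          using u(1) \<open>p \<in>\<^sub>M P\<close> unfolding D q by blast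
      qed
    qed
    then show ?thesis unfolding dense_in_def by (simp add: subset_def D)
  qed
  have "\<exists>G. generic_filter P q (Repl om D) G"
  proof -
    have "nonempty P" using t0P by (auto simp: nonempty_def)
    moreover have "\<forall>A. A \<in>\<^sub>M Repl om D \<longrightarrow> dense_in P q A"
      using dense unfolding mem_Repl[OF tdf_D] by blast
    ultimately show ?thesis
      using generic po_q cuf countable_Repl[OF countable_om tdf_D] unfolding generic_filters_exist_def by blast
  qed

  \<comment> \<open>The generic filter as an infinite branch\<close>
  then obtain G where G: "filter_in P q G" "\<forall>A. A \<in>\<^sub>M Repl om D \<longrightarrow> (\<exists>x. x \<in>\<^sub>M G \<and> x \<in>\<^sub>M A)"
    unfolding generic_filter_def by blast
  have GP: "g \<in>\<^sub>M P" if "g \<in>\<^sub>M G" for g using G(1) that unfolding filter_in_def subset_def by blast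
  have GT: "g \<in>\<^sub>M T" if "g \<in>\<^sub>M G" for g using GP that P by blast
  \<comment> \<open>The cone of \<open>t\<close> contains that of \<open>g\<close>, so
    \<open>t\<close> is a condition too; in the reversed order it is weaker than \<open>g\<close>,
    and filters are closed upwards.\<close>
  have Gdown: "t \<in>\<^sub>M G" if "g \<in>\<^sub>M G" "rel r t g" for t g
  proof -
    have "subset (up g) (up t)" using that(2) po(5) unfolding subset_def up by blast
    then have "t \<in>\<^sub>M P" using GP[OF that(1)] finite_subset po(1)[OF that(2)] unfolding P by blast
    then have "rel q g t" using that GP by (simp add: q)
    then show ?thesis using G(1) that(1) unfolding filter_in_def by blast
  qed
  have high: "\<exists>g. g \<in>\<^sub>M G \<and> n \<in>\<^sub>M ht g" if n: "n \<in>\<^sub>M om" for n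
  proof -
    \<comment> \<open>The successor of \<open>n\<close> is used so that \<open>n\<close> becomes an
      element of the height, that is, the height exceeds \<open>n\<close> strictly.\<close>
    have "D (ins n n) \<in>\<^sub>M Repl om D" using om_succ[OF n] by (auto simp: mem_Repl[OF tdf_D])
    then obtain g where "g \<in>\<^sub>M G" "g \<in>\<^sub>M D (ins n n)" using G(2) by blast
    then show ?thesis by (auto simp: D subset_def)
  qed
  have "branch T r G" unfolding branch_def
  proof (intro conjI allI impI)
    show "chain T r G" unfolding chain_def
    proof (intro conjI allI impI)
      show "subset G T" using GT by (simp add: subset_def)
      show "rel r s t \<or> rel r t s" if "s \<in>\<^sub>M G \<and> t \<in>\<^sub>M G" for s t
      proof -
        have "\<exists>v. v \<in>\<^sub>M G \<and> rel q v s \<and> rel q v t" using G(1) that unfolding filter_in_def by blast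
        then show ?thesis using linear unfolding q by blast
      qed
    qed
    fix c assume "chain T r c \<and> subset G c"
    then have c: "chain T r c" and "subset G c" by blast+
    show "c = G"
    proof (rule subset_antisym[OF _ \<open>subset G c\<close>], unfold subset_def, intro allI impI)
      fix t assume t: "t \<in>\<^sub>M c"
      then have tT: "t \<in>\<^sub>M T" using c unfolding chain_def subset_def by blast
      obtain g where g: "g \<in>\<^sub>M G" "ht t \<in>\<^sub>M ht g" using high[OF ht_om[OF tT]] by blast
      then have "rel r t g \<or> rel r g t" using c t \<open>subset G c\<close> unfolding chain_def subset_def by blast
      \<comment> \<open>\<open>g\<close> was taken higher than \<open>t\<close>, whereas heights are
        monotone along the tree order. So \<open>t\<close> lies below \<open>g\<close>, and
        \<open>Gdown\<close> puts it into \<open>G\<close>.\<close>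
      moreover have "\<not> rel r g t"
      proof
        assume gt: "rel r g t"
        have "subset (pred g) (pred t)" using gt str(2) by (auto simp: subset_def pred)
        then have "subset (ht g) (ht t)" unfolding ht_def by (rule card_mono[OF fin_pred[OF tT]])
        then have "ht t \<in>\<^sub>M ht t" using g(2) unfolding subset_def by blast
        then show False by simp
      qed
      ultimately show "t \<in>\<^sub>M G" using Gdown g(1) by blast
    qed
  qed
  moreover have "\<not> finite_set G"
  proof
    assume "finite_set G"
    \<comment> \<open>Each height is a finite set, and by \<open>high\<close> together they cover
      \<open>om\<close>.\<close>
    then have "finite_set (un (Repl G ht))"
      by (rule finite_UN[OF _ tdf_ht]) (use ht_om GT finite_om in blast)
    moreover have "subset om (un (Repl G ht))"
      using high unfolding subset_def mem_un mem_Repl[OF tdf_ht] by blast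
    ultimately show False using finite_subset infinite_om by blast
  qed
  ultimately show "\<exists>b. branch T r b \<and> \<not> finite_set b" by blast
qed

subsection \<open>Koenig's Lemma implies countable choice for finite sets\<close>

lemma function_on_mem:
  assumes f: "function_on f a" shows "z \<in>\<^sub>M f \<longleftrightarrow> (\<exists>x. x \<in>\<^sub>M a \<and> z = opair x (app f x))"
proof
  assume z: "z \<in>\<^sub>M f"
  then obtain x y where xy: "z = opair x y" using f unfolding function_on_def is_opair_iff' by blast
  then have "rel f x y" using z by (simp add: rel_iff)
  then show "\<exists>x. x \<in>\<^sub>M a \<and> z = opair x (app f x)" using function_on_rel[OF f] xy by simp
next
  assume "\<exists>x. x \<in>\<^sub>M a \<and> z = opair x (app f x)"
  then show "z \<in>\<^sub>M f" using function_on_rel[OF f] by (auto simp: rel_iff)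
qed

lemma function_on_subset_iff:
  assumes "function_on f a" "function_on g b"
  shows "subset f g \<longleftrightarrow> subset a b \<and> (\<forall>x. x \<in>\<^sub>M a \<longrightarrow> app g x = app f x)"
  unfolding subset_def function_on_mem[OF assms(1)] function_on_mem[OF assms(2)] by auto

lemma function_on_unique: assumes "function_on f a" "function_on f b" shows "a = b"
  by (rule subset_antisym)
    (use function_on_subset_iff[OF assms] function_on_subset_iff[OF assms(2,1)] in \<open>auto simp: subset_def\<close>)

lemma Koenig_imp_choice:
  assumes Koenig: Koenigs_lemma
  shows countable_choice_for_finite_sets
  unfolding countable_choice_for_finite_sets_def
proof (intro allI impI, elim conjE)
  fix F
  assume "countable_set F" and F: "\<forall>x. x \<in>\<^sub>M F \<longrightarrow> nonempty x \<and> finite_set x"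
  obtain i where i: "tdf1 i" "inj_on i (ext F)" "\<And>x. x \<in>\<^sub>M F \<Longrightarrow> i x \<in>\<^sub>M om"
    using countableE[OF \<open>countable_set F\<close>] by metis
  \<comment> \<open>Numbers that are not codes of members of \<open>F\<close> receive a dummy
    one-element set. Hence every \<open>G n\<close> is nonempty and finite, and the tree has nodes
    of every height even when \<open>F\<close> is finite.\<close>
  define G where "G n = (if \<exists>x. x \<in>\<^sub>M F \<and> i x = n then desc (\<lambda>x. x \<in>\<^sub>M F \<and> i x = n) else ins emp emp)" for n
  have tdf_G: "tdf1 G" unfolding G_def by (intro dfn_intros tdf1_app[OF i(1)])
  have Gi: "G (i x) = x" if x: "x \<in>\<^sub>M F" for x
  proof -
    have "y = x" if "y \<in>\<^sub>M F \<and> i y = i x" for y using inj_onD[OF i(2), of y x] x that by simp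
    then have "desc (\<lambda>y. y \<in>\<^sub>M F \<and> i y = i x) = x" using x by (intro desc_eq) blast+
    then show ?thesis using x unfolding G_def by auto
  qed
  have G: "nonempty (G n) \<and> finite_set (G n)" for n
  proof (cases "\<exists>x. x \<in>\<^sub>M F \<and> i x = n")
    case True
    then obtain x where x: "x \<in>\<^sub>M F" "i x = n" by blast
    then show ?thesis using F Gi[OF x(1)] by simp
  next
    case False
    then have "G n = ins emp emp" unfolding G_def by (rule if_not_P)
    then show ?thesis using finite_ins[OF finite_emp] by (auto simp: nonempty_def)
  qed

  \<comment> \<open>The finite choice sequences\<close>
  define seq where "seq s n \<longleftrightarrow> function_on s n \<and> (\<forall>k. k \<in>\<^sub>M n \<longrightarrow> app s k \<in>\<^sub>M G k)" for s n
  define T where "T = Sep (Pw (prod om (un (Repl om G)))) (\<lambda>s. \<exists>n. n \<in>\<^sub>M om \<and> seq s n)"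
  have T: "s \<in>\<^sub>M T \<longleftrightarrow> (\<exists>n. n \<in>\<^sub>M om \<and> seq s n)" for s
  proof -
    have "s \<in>\<^sub>M T \<longleftrightarrow> s \<in>\<^sub>M Pw (prod om (un (Repl om G))) \<and> (\<exists>n. n \<in>\<^sub>M om \<and> seq s n)"
      unfolding T_def by (rule mem_Sep) (unfold seq_def, intro dfn_intros tdf1_app[OF tdf_G])
    moreover have "subset s (prod om (un (Repl om G)))" if n: "n \<in>\<^sub>M om" and s: "seq s n" for n
    proof -
      have "app s k \<in>\<^sub>M un (Repl om G)" if "k \<in>\<^sub>M n" for k
        using s om_trans[OF n that] that unfolding seq_def mem_un mem_Repl[OF tdf_G] by blast
      then show ?thesis
        unfolding subset_def function_on_mem[OF conjunct1[OF s[unfolded seq_def]]]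
        using om_trans[OF n] by auto
    qed
    ultimately show ?thesis by auto
  qed
  \<comment> \<open>The length of a sequence, recovered from the set \<open>s\<close> alone; it will
    be the height of \<open>s\<close> in the tree.\<close>
  define dm where "dm s = desc (\<lambda>n. function_on s n)" for s
  have tdf_dm: "tdf1 dm" unfolding dm_def by (intro dfn_intros)
  have dm_eq: "dm s = n" if "function_on s n" for s n
    unfolding dm_def using that function_on_unique by (intro desc_eq) blast+
  have dm: "dm s \<in>\<^sub>M om" "function_on s (dm s)" "\<And>k. k \<in>\<^sub>M dm s \<Longrightarrow> app s k \<in>\<^sub>M G k" if s: "s \<in>\<^sub>M T" for s
  proof -
    obtain n where "n \<in>\<^sub>M om" "seq s n" using s T by blast
    then show "dm s \<in>\<^sub>M om" "function_on s (dm s)" "\<And>k. k \<in>\<^sub>M dm s \<Longrightarrow> app s k \<in>\<^sub>M G k"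
      using dm_eq unfolding seq_def by blast+
  qed
  have sub_iff: "subset s t \<longleftrightarrow> subset (dm s) (dm t) \<and> (\<forall>k. k \<in>\<^sub>M dm s \<longrightarrow> app t k = app s k)"
    if "s \<in>\<^sub>M T" "t \<in>\<^sub>M T" for s t
    using function_on_subset_iff dm(2) that by blast
  \<comment> \<open>Two initial segments of a common sequence \<open>u\<close> agree wherever both
    are defined, so their lengths decide which extends the other.\<close>
  have sub_linear: "subset s t" if "s \<in>\<^sub>M T" "t \<in>\<^sub>M T" "u \<in>\<^sub>M T" "subset s u" "subset t u" "subset (dm s) (dm t)" for s t u
  proof -
    have "app t k = app s k" if "k \<in>\<^sub>M dm s" for k
      using sub_iff[of s u] sub_iff[of t u] that \<open>s \<in>\<^sub>M T\<close> \<open>t \<in>\<^sub>M T\<close> \<open>u \<in>\<^sub>M T\<close> \<open>subset s u\<close> \<open>subset t u\<close>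
        \<open>subset (dm s) (dm t)\<close> unfolding subset_def by metis
    then show ?thesis using sub_iff that by blast
  qed
  have sub_same: "s = t" if "s \<in>\<^sub>M T" "t \<in>\<^sub>M T" "subset s t" "dm s = dm t" for s t
    using sub_iff[of s t] sub_iff[of t s] that subset_antisym by simp

  \<comment> \<open>The order by extension\<close>
  define r where "r = Sep (prod T T) (\<lambda>z. \<exists>s t. z = opair s t \<and> subset s t)"
  have mem_r: "z \<in>\<^sub>M r \<longleftrightarrow> z \<in>\<^sub>M prod T T \<and> (\<exists>s t. z = opair s t \<and> subset s t)" for z
    unfolding r_def by (rule mem_Sep) (intro dfn_intros)
  have r: "rel r s t \<longleftrightarrow> s \<in>\<^sub>M T \<and> t \<in>\<^sub>M T \<and> subset s t" for s t
    unfolding rel_iff[of r] mem_r by auto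
  have po: "partial_order T r"
    unfolding partial_order_def is_opair_iff'
  proof (intro conjI allI impI)
    show "\<exists>x y. p = opair x y \<and> x \<in>\<^sub>M T \<and> y \<in>\<^sub>M T" if "p \<in>\<^sub>M r" for p
      using that mem_prod unfolding mem_r by blast
    show "rel r x x" if "x \<in>\<^sub>M T" for x using that unfolding r subset_def by blast
    show "x = y" if "rel r x y \<and> rel r y x" for x y using that subset_antisym unfolding r by blast
    show "rel r x z" if "rel r x y \<and> rel r y z" for x y z using that unfolding r subset_def by blast
  qed
  have strict_dm: "dm s \<in>\<^sub>M dm t" if st: "strict r s t" for s t
  proof -
    have *: "s \<in>\<^sub>M T" "t \<in>\<^sub>M T" "subset s t" "s \<noteq> t" using st by (auto simp: strict_def r)
    then have "subset (dm s) (dm t)" "dm s \<noteq> dm t" using sub_iff sub_same by blast+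
    then show ?thesis using om_subset_iff dm(1) * by blast
  qed

  \<comment> \<open>Restrictions and one-point extensions\<close>
  define rs where "rs s m = lam m (\<lambda>k. app s k)" for s m
  have rs: "rs s m \<in>\<^sub>M T" "dm (rs s m) = m" "subset (rs s m) s"
    if s: "s \<in>\<^sub>M T" and m: "m \<in>\<^sub>M om" "subset m (dm s)" for s m
  proof -
    have tdf: "tdf1 (app s)" by (intro dfn_intros)
    have f: "function_on (rs s m) m" unfolding rs_def by (rule function_on_lam[OF tdf])
    have a: "app (rs s m) k = app s k" if "k \<in>\<^sub>M m" for k unfolding rs_def by (rule app_lam[OF tdf that])
    show dm_rs: "dm (rs s m) = m" by (rule dm_eq[OF f])
    have "seq (rs s m) m" using f a dm(3)[OF s] m(2) unfolding seq_def subset_def by simp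
    then show T: "rs s m \<in>\<^sub>M T" using T m(1) by blast
    show "subset (rs s m) s" using sub_iff[OF T s] dm_rs m(2) a by simp
  qed
  have ext: "ins (opair n y) s \<in>\<^sub>M T" "dm (ins (opair n y) s) = ins n n"
      "subset s (ins (opair n y) s)" "app (ins (opair n y) s) n = y"
    if s: "s \<in>\<^sub>M T" and n: "dm s = n" and y: "y \<in>\<^sub>M G n" for s n y
  proof -
    let ?s = "ins (opair n y) s"
    have rel: "rel ?s k z \<longleftrightarrow> k = n \<and> z = y \<or> k \<in>\<^sub>M n \<and> z = app s k" for k z
      using function_on_rel[OF dm(2)[OF s]] n by (auto simp: rel_iff)
    have mem: "p \<in>\<^sub>M ?s \<longleftrightarrow> p = opair n y \<or> (\<exists>k. k \<in>\<^sub>M n \<and> p = opair k (app s k))" for p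
      using function_on_mem[OF dm(2)[OF s]] n by auto
    \<comment> \<open>The new argument \<open>n\<close> is not an element of \<open>n\<close>, so
      the added pair cannot conflict with a value of \<open>s\<close>.\<close>
    have f: "function_on ?s (ins n n)"
      unfolding function_on_def is_opair_iff'
    proof (intro conjI allI impI)
      show "\<exists>k z. p = opair k z \<and> k \<in>\<^sub>M ins n n" if "p \<in>\<^sub>M ?s" for p using that unfolding mem by auto
      show "\<exists>!z. rel ?s k z" if "k \<in>\<^sub>M ins n n" for k
        using that mem_irrefl[of n] unfolding rel mem_ins by (cases "k = n") auto
    qed
    show app_n: "app ?s n = y" using function_on_rel[OF f, of n y] rel[of n y] by simp
    have app: "app ?s k = app s k" if "k \<in>\<^sub>M n" for k
      using function_on_rel[OF f, of k "app s k"] rel[of k "app s k"] that by simp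
    have "seq ?s (ins n n)"
      using f app_n app dm(3)[OF s] n y unfolding seq_def by auto
    moreover have "n \<in>\<^sub>M om" using dm(1)[OF s] n by simp
    ultimately show "?s \<in>\<^sub>M T" unfolding T using om_succ by blast
    show "dm ?s = ins n n" by (rule dm_eq[OF f])
    show "subset s ?s" by (simp add: subset_def)
  qed
  have emp: "emp \<in>\<^sub>M T" "dm emp = emp"
  proof -
    have "function_on emp emp" by (simp add: function_on_def)
    then show "emp \<in>\<^sub>M T" "dm emp = emp" unfolding T seq_def using dm_eq by (auto intro!: exI[of _ emp])
  qed
  have levels: "\<exists>s. s \<in>\<^sub>M T \<and> dm s = n" if n: "n \<in>\<^sub>M om" for n
  proof -
    have "dfn1 (\<lambda>n. \<exists>s. s \<in>\<^sub>M T \<and> dm s = n)" by (intro dfn_intros tdf1_app[OF tdf_dm])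
    with n show ?thesis
    proof (induct rule: om_induct)
      case zero then show ?case using emp by blast
    next
      case (succ n)
      then obtain s where s: "s \<in>\<^sub>M T" "dm s = n" by blast
      obtain y where "y \<in>\<^sub>M G n" using G unfolding nonempty_def by blast
      then show ?case using ext[OF s] by blast
    qed
  qed

  \<comment> \<open>The hypotheses of Koenig's Lemma\<close>
  have "tree T r" unfolding tree_def
  proof (intro conjI allI impI po)
    fix t A assume *: "t \<in>\<^sub>M T \<and> nonempty A \<and> (\<forall>s. s \<in>\<^sub>M A \<longrightarrow> strict r s t)"
    then have A: "s \<in>\<^sub>M T" "subset s t" if "s \<in>\<^sub>M A" for s using that unfolding strict_def r by blast+
    obtain s where s: "s \<in>\<^sub>M A" using * unfolding nonempty_def by blast
    \<comment> \<open>A member of \<open>A\<close> of minimal length is least, because all members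
      are initial segments of \<open>t\<close>.\<close>
    have "dfn1 (\<lambda>n. \<exists>s. s \<in>\<^sub>M A \<and> dm s = n)" by (intro dfn_intros tdf1_app[OF tdf_dm])
    from om_least[OF this dm(1)[OF A(1)[OF s]]] s obtain m where
      "m \<in>\<^sub>M A" "\<And>s. s \<in>\<^sub>M A \<Longrightarrow> dm m \<in>\<^sub>M dm s \<or> dm m = dm s" using dm(1) A(1) by metis
    then have m: "m \<in>\<^sub>M A" "\<And>s. s \<in>\<^sub>M A \<Longrightarrow> subset (dm m) (dm s)"
      using om_subset_iff dm(1) A(1) by blast+
    have "rel r m s" if "s \<in>\<^sub>M A" for s
      using sub_linear[of m s t] m A * that unfolding r by blast
    then show "\<exists>m. m \<in>\<^sub>M A \<and> (\<forall>s. s \<in>\<^sub>M A \<longrightarrow> rel r m s)" using m(1) by blast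
  qed
  moreover have "rooted T r"
    unfolding rooted_def r using emp(1) by (intro exI[of _ emp]) (auto simp: subset_def)
  moreover have "height_omega T r"
  proof -
    have height: "node_height r t (dm t)" if t: "t \<in>\<^sub>M T" for t
    proof -
      define p where "p = Sep T (\<lambda>s. strict r s t)"
      have "s \<in>\<^sub>M p \<longleftrightarrow> s \<in>\<^sub>M T \<and> strict r s t" for s unfolding p_def by (rule mem_Sep) (intro dfn_intros)
      then have p: "s \<in>\<^sub>M p \<longleftrightarrow> strict r s t" for s unfolding strict_def r by blast
      have pT: "s \<in>\<^sub>M T" "subset s t" if "s \<in>\<^sub>M p" for s using that unfolding p strict_def r by blast+
      have sub: "subset s s'" if "s \<in>\<^sub>M p" "s' \<in>\<^sub>M p" "dm s \<in>\<^sub>M dm s' \<or> dm s = dm s'" for s s'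
      proof -
        have "subset (dm s) (dm s')" using om_subset_iff dm(1) pT(1) that by blast
        then show ?thesis using sub_linear pT that(1,2) t by blast
      qed
      \<comment> \<open>Lengths identify the predecessors of \<open>t\<close> with the elements of
        \<open>dm t\<close>: predecessors of equal length coincide, and the restriction of
        \<open>t\<close> to \<open>m\<close> has length \<open>m\<close>.\<close>
      have "bij_betw dm (ext p) (ext (dm t))"
      proof (rule bij_betw_imageI)
        show "inj_on dm (ext p)"
          by (rule inj_onI, unfold mem_ext) (use sub sub_same pT in blast)
        have "\<exists>s. s \<in>\<^sub>M p \<and> dm s = m" if m: "m \<in>\<^sub>M dm t" for m
        proof -
          have "m \<in>\<^sub>M om" using om_trans dm(1) t m by blast
          moreover have "subset m (dm t)" using om_subset_iff dm(1)[OF t] \<open>m \<in>\<^sub>M om\<close> m by blast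
          ultimately have "rs t m \<in>\<^sub>M T" "dm (rs t m) = m" "subset (rs t m) t" using rs t by blast+
          moreover have "rs t m \<noteq> t" using \<open>dm (rs t m) = m\<close> m by auto
          ultimately show ?thesis using t unfolding p strict_def r by blast
        qed
        moreover have "dm s \<in>\<^sub>M dm t" if "s \<in>\<^sub>M p" for s using strict_dm that p by blast
        ultimately show "dm ` ext p = ext (dm t)"
          unfolding set_eq_iff image_iff Bex_def mem_ext by blast
      qed
      then have "bij_betw (app (lam p dm)) (ext p) (ext (dm t))"
        by (subst bij_betw_cong[of _ _ dm]) (simp_all add: app_lam[OF tdf_dm])
      then have "bijection (lam p dm) p (dm t)"
        unfolding bijection_iff using function_on_lam[OF tdf_dm] by blast
      moreover have "strict r s s' \<longleftrightarrow> dm s \<in>\<^sub>M dm s'" if "s \<in>\<^sub>M p" "s' \<in>\<^sub>M p" for s s'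
        using strict_dm[of s s'] sub[OF that] pT that mem_irrefl unfolding strict_def r by metis
      then have "\<forall>s s' m m'. rel (lam p dm) s m \<and> rel (lam p dm) s' m' \<longrightarrow> (strict r s s' \<longleftrightarrow> m \<in>\<^sub>M m')"
        unfolding rel_lam[OF tdf_dm] by blast
      ultimately show ?thesis unfolding node_height_def using p by blast
    qed
    have "\<exists>t. t \<in>\<^sub>M T \<and> node_height r t n" if "n \<in>\<^sub>M om" for n
      using levels[OF that] height by blast
    then show ?thesis unfolding height_omega_def is_omega_iff using height dm(1) by blast
  qed
  moreover have "finitely_branching T r"
    unfolding finitely_branching_def
  proof (intro allI impI)
    fix s assume s: "s \<in>\<^sub>M T"
    let ?g = "\<lambda>y. ins (opair (dm s) y) s"
    have g: "tdf1 ?g" by (intro dfn_intros)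
    \<comment> \<open>No length fits strictly between \<open>dm s\<close> and its successor, so
      one-point extensions are immediate. Conversely, \<open>t\<close> extends the one-point
      extension of \<open>s\<close> by its own value at \<open>dm s\<close>, and immediacy makes
      them equal.\<close>
    have "t \<in>\<^sub>M Repl (G (dm s)) ?g \<longleftrightarrow> immediate_succ r s t" for t
    proof
      assume "t \<in>\<^sub>M Repl (G (dm s)) ?g"
      then obtain y where y: "y \<in>\<^sub>M G (dm s)" and t: "t = ?g y" by (auto simp: mem_Repl[OF g])
      note e = ext[OF s refl y, folded t]
      have "s \<noteq> t" using e(2) by (metis mem_ins mem_irrefl)
      then have "strict r s t" using e s unfolding strict_def r by blast
      moreover have "\<not> (strict r s u \<and> strict r u t)" for u
      proof
        assume "strict r s u \<and> strict r u t"
        then have "dm s \<in>\<^sub>M dm u" "dm u \<in>\<^sub>M ins (dm s) (dm s)" using strict_dm e(2) by metis+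
        then show False using mem_asym by auto
      qed
      ultimately show "immediate_succ r s t" unfolding immediate_succ_def by blast
    next
      assume st: "immediate_succ r s t"
      then have st': "strict r s t" by (simp add: immediate_succ_def)
      have t: "t \<in>\<^sub>M T" "subset s t" using st' by (auto simp: strict_def r)
      have n: "dm s \<in>\<^sub>M dm t" by (rule strict_dm[OF st'])
      have y: "app t (dm s) \<in>\<^sub>M G (dm s)" using dm(3)[OF t(1) n] .
      let ?u = "?g (app t (dm s))"
      note e = ext[OF s refl y]
      have "opair (dm s) (app t (dm s)) \<in>\<^sub>M t" using function_on_mem[OF dm(2)[OF t(1)]] n by blast
      then have "subset ?u t" using t(2) by (auto simp: subset_def)
      then have ut: "rel r ?u t" using e t by (simp add: r)
      have "s \<noteq> ?u" using e(2) by (metis mem_ins mem_irrefl)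
      then have "strict r s ?u" using e s unfolding strict_def r by blast
      then have "\<not> strict r ?u t" using st unfolding immediate_succ_def by blast
      then have "?u = t" using ut unfolding strict_def by blast
      then show "t \<in>\<^sub>M Repl (G (dm s)) ?g"
        unfolding mem_Repl[OF g] by (intro exI[of _ "app t (dm s)"] conjI y) (rule sym)
    qed
    moreover have "finite_set (Repl (G (dm s)) ?g)" using finite_Repl[OF _ g] G by blast
    ultimately show "\<exists>S. (\<forall>t. t \<in>\<^sub>M S \<longleftrightarrow> immediate_succ r s t) \<and> finite_set S" by blast
  qed
  moreover have "\<not> finite_set T"
  proof
    assume "finite_set T"
    then have "finite_set (Repl T dm)" by (rule finite_Repl[OF _ tdf_dm])
    moreover have "subset om (Repl T dm)" using levels unfolding subset_def mem_Repl[OF tdf_dm] by metis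
    ultimately show False using finite_subset infinite_om by blast
  qed
  ultimately obtain b where b: "branch T r b" "\<not> finite_set b"
    using Koenig unfolding Koenigs_lemma_def by blast

  \<comment> \<open>The choice function read off from the branch\<close>
  have bT: "s \<in>\<^sub>M T" if "s \<in>\<^sub>M b" for s using b(1) that unfolding branch_def chain_def subset_def by blast
  have b_chain: "subset s t \<or> subset t s" if "s \<in>\<^sub>M b" "t \<in>\<^sub>M b" for s t
    using b(1) that r unfolding branch_def chain_def by blast
  \<comment> \<open>Along a chain the length determines the sequence. If no length exceeded
    \<open>n\<close>, then \<open>dm\<close> would inject \<open>b\<close> into the finite set
    \<open>n + 1\<close>.\<close>
  have long: "\<exists>s. s \<in>\<^sub>M b \<and> n \<in>\<^sub>M dm s" if n: "n \<in>\<^sub>M om" for n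
  proof (rule ccontr)
    assume no: "\<not> ?thesis"
    have "dm s \<in>\<^sub>M ins n n" if "s \<in>\<^sub>M b" for s
      using om_linear[OF n dm(1)[OF bT[OF that]]] no that by auto
    moreover have "inj_on dm (ext b)"
    proof (rule inj_onI, unfold mem_ext)
      fix s t assume "s \<in>\<^sub>M b" "t \<in>\<^sub>M b" "dm s = dm t"
      then show "s = t" using b_chain sub_same[of s t] sub_same[of t s] bT by metis
    qed
    ultimately have "finite_set b" using finite_inj[OF tdf_dm] finite_om[OF om_succ[OF n]] by blast
    then show False using b(2) by simp
  qed
  have b_rel: "k \<in>\<^sub>M dm s" "y = app s k" if "s \<in>\<^sub>M b" "rel s k y" for s k y
    using function_on_rel[OF dm(2)[OF bT[OF that(1)]]] that(2) by auto
  have b_unique: "y = z" if "s \<in>\<^sub>M b" "t \<in>\<^sub>M b" "rel s k y" "rel t k z" for s t k y z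
  proof (cases "subset s t")
    case True
    then have "rel t k y" using that unfolding rel_iff subset_def by blast
    then show ?thesis using b_rel that by metis
  next
    case False
    then have "rel s k z" using that b_chain unfolding rel_iff subset_def by blast
    then show ?thesis using b_rel that by metis
  qed
  \<comment> \<open>The union of the branch is a function on all of \<open>om\<close>;
    \<open>c\<close> evaluates it at the code \<open>i x\<close>. Its value lies in \<open>x\<close>
    because \<open>G (i x) = x\<close>.\<close>
  define c where "c = Sep (prod F (un F)) (\<lambda>z. \<exists>x y s. z = opair x y \<and> s \<in>\<^sub>M b \<and> rel s (i x) y)"
  have mem_c: "z \<in>\<^sub>M c \<longleftrightarrow> z \<in>\<^sub>M prod F (un F) \<and> (\<exists>x y s. z = opair x y \<and> s \<in>\<^sub>M b \<and> rel s (i x) y)" for z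
    unfolding c_def by (rule mem_Sep) (intro dfn_intros tdf1_app[OF i(1)])
  have in_x: "y \<in>\<^sub>M x" if "x \<in>\<^sub>M F" "s \<in>\<^sub>M b" "rel s (i x) y" for x y s
    using dm(3)[OF bT[OF that(2)] b_rel(1)[OF that(2,3)]] b_rel(2)[OF that(2,3)] Gi[OF that(1)] by simp
  have c: "rel c x y \<longleftrightarrow> x \<in>\<^sub>M F \<and> (\<exists>s. s \<in>\<^sub>M b \<and> rel s (i x) y)" for x y
    unfolding rel_iff[of c] mem_c using in_x by auto
  have "choice_function c F"
    unfolding choice_function_def function_on_def is_opair_iff'
  proof (intro conjI allI impI)
    show "\<exists>x y. p = opair x y \<and> x \<in>\<^sub>M F" if "p \<in>\<^sub>M c" for p using that mem_prod unfolding mem_c by blast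
    show "y \<in>\<^sub>M x" if "rel c x y" for x y using that in_x unfolding c by blast
    show "\<exists>!y. rel c x y" if x: "x \<in>\<^sub>M F" for x
    proof (rule ex_ex1I)
      obtain s where s: "s \<in>\<^sub>M b" "i x \<in>\<^sub>M dm s" using long[OF i(3)[OF x]] by blast
      then have "rel s (i x) (app s (i x))" using function_on_rel[OF dm(2)[OF bT[OF s(1)]]] by simp
      then show "\<exists>y. rel c x y" using s(1) x unfolding c by blast
      show "y = z" if "rel c x y" "rel c x z" for y z using that b_unique unfolding c by blast
    qed
  qed
  then show "\<exists>c. choice_function c F" ..
qed

end

theorem theorem2p6:
  fixes E :: "'a \<Rightarrow> 'a \<Rightarrow> bool"
  assumes "ZF_model E"
  shows "(set_structure.countable_choice_for_finite_sets E \<longleftrightarrow> set_structure.Koenigs_lemma E) \<and>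
         (set_structure.Koenigs_lemma E \<longleftrightarrow> set_structure.countable_unions_of_finite_sets_countable E) \<and>
         (set_structure.countable_unions_of_finite_sets_countable E \<longleftrightarrow> set_structure.generic_filters_exist E)"
proof -
  interpret ZF_model E by (rule assms)
  show ?thesis
    using choice_imp_unions_countable unions_countable_imp_generic generic_imp_Koenig Koenig_imp_choice
    by blast
qed

end
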